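(* There are codimension one "rare species" foliations on open surfaces contained in $\mathbb{R}^2$. In particular, for these foliations the union of locally dense leaves is not open.
   Context: An open surface contained in $\mathbb{R}^2$ is a non-compact surface without boundary which is a subset of $\mathbb{R}^2$. Foliations here are continuous. A leaf of a codimension one foliation is proper if it is embedded, locally dense if its closure has nonempty interior, and exceptional if it is neither proper nor locally dense. A foliation $\mathcal{F}$ on a manifold is "rare species" if either all leaves are exceptional, or $\mathcal{F}$ has leaves of at least two of the three types (proper, locally dense, exceptional) and, for each of the types that occur, the union of the leaves of that type is dense. *)

theory Defs
  imports "HOL-Analysis.Analysis"
begin

text \<open>
  Surfaces are connected. A subset of the plane is automatically Hausdorff and second countable,
  so these conditions on a surface do not appear.
\<close>

definition open_surface_in_plane :: "(real \<times> real) set \<Rightarrow> bool" where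
  "open_surface_in_plane S \<longleftrightarrow>
     S \<noteq> {} \<and> connected S \<and> \<not> compact S \<and>
     (\<forall>p\<in>S. \<exists>U. openin (top_of_set S) U \<and> p \<in> U \<and>
        (\<exists>V :: (real \<times> real) set. open V \<and> U homeomorphic V))"

text \<open>
  A chart is a pair of a domain and a map; values of the map outside the domain are irrelevant.
  The first coordinate of a foliated chart runs along the leaves, the second one is transverse.
\<close>

type_synonym 'a chart = "'a set \<times> ('a \<Rightarrow> real \<times> real)"

definition foliated_chart :: "'a::topological_space set \<Rightarrow> 'a chart \<Rightarrow> bool" where
  "foliated_chart S = (\<lambda>(U, \<phi>). openin (top_of_set S) U \<and>
     (\<exists>I J \<psi>. open I \<and> connected I \<and> I \<noteq> {} \<and> open J \<and> connected J \<and> J \<noteq> {} \<and>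
        homeomorphism U (I \<times> J) \<phi> \<psi>))"

text \<open>
  The change of coordinates is locally of the form \<open>(x, y) \<mapsto> (g (x, y), h y)\<close>.  As charts are
  homeomorphisms, \<open>g\<close> exists anyway and both functions are continuous where they matter.
\<close>

definition foliated_compatible ::
    "'a::topological_space set \<Rightarrow> 'a chart \<Rightarrow> 'a chart \<Rightarrow> bool" where
  "foliated_compatible S = (\<lambda>(U, \<phi>) (V, \<psi>).
     \<forall>p\<in>U \<inter> V. \<exists>W g h. openin (top_of_set S) W \<and> p \<in> W \<and> W \<subseteq> U \<inter> V \<and>
       (\<forall>q\<in>W. \<psi> q = (g (\<phi> q), h (snd (\<phi> q)))))"

text \<open>
  A continuous codimension one foliation of a surface \<open>S\<close>, given by a foliated atlas.  The atlas
  need not be maximal; the leaves and their topology are the same for every compatible atlas.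
\<close>

definition codim_one_foliation :: "'a::topological_space set \<Rightarrow> 'a chart set \<Rightarrow> bool" where
  "codim_one_foliation S \<F> \<longleftrightarrow>
     (\<forall>c\<in>\<F>. foliated_chart S c) \<and> (\<Union>c\<in>\<F>. fst c) = S \<and>
     (\<forall>c\<in>\<F>. \<forall>d\<in>\<F>. foliated_compatible S c d)"

definition plaques :: "'a chart set \<Rightarrow> 'a set set" where
  "plaques \<F> = {{p \<in> U. snd (\<phi> p) = y} | U \<phi> y. (U, \<phi>) \<in> \<F> \<and> y \<in> snd ` \<phi> ` U}"

definition leaf_topology :: "'a::topological_space set \<Rightarrow> 'a chart set \<Rightarrow> 'a topology" where
  "leaf_topology S \<F> =
     topology_generated_by {W \<inter> P | W P. openin (top_of_set S) W \<and> P \<in> plaques \<F>}"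

definition leaves :: "'a::topological_space set \<Rightarrow> 'a chart set \<Rightarrow> 'a set set" where
  "leaves S \<F> = connected_components_of (leaf_topology S \<F>)"

definition proper_leaf :: "'a::topological_space set \<Rightarrow> 'a chart set \<Rightarrow> 'a set \<Rightarrow> bool" where
  "proper_leaf S \<F> L \<longleftrightarrow>
     embedding_map (subtopology (leaf_topology S \<F>) L) (top_of_set S) (\<lambda>p. p)"

definition locally_dense_leaf :: "'a::topological_space set \<Rightarrow> 'a set \<Rightarrow> bool" where
  "locally_dense_leaf S L \<longleftrightarrow>
     (top_of_set S) interior_of ((top_of_set S) closure_of L) \<noteq> {}"

datatype leaf_type = Proper | Locally_dense | Exceptional

fun leaf_has_type ::
    "'a::topological_space set \<Rightarrow> 'a chart set \<Rightarrow> leaf_type \<Rightarrow> 'a set \<Rightarrow> bool" where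
  "leaf_has_type S \<F> Proper L \<longleftrightarrow> proper_leaf S \<F> L"
| "leaf_has_type S \<F> Locally_dense L \<longleftrightarrow> locally_dense_leaf S L"
| "leaf_has_type S \<F> Exceptional L \<longleftrightarrow> \<not> proper_leaf S \<F> L \<and> \<not> locally_dense_leaf S L"

definition leaves_of_type ::
    "'a::topological_space set \<Rightarrow> 'a chart set \<Rightarrow> leaf_type \<Rightarrow> 'a set set" where
  "leaves_of_type S \<F> t = {L \<in> leaves S \<F>. leaf_has_type S \<F> t L}"

definition rare_species :: "'a::topological_space set \<Rightarrow> 'a chart set \<Rightarrow> bool" where
  "rare_species S \<F> \<longleftrightarrow>
     (\<forall>L\<in>leaves S \<F>. leaf_has_type S \<F> Exceptional L) \<or>
     (card {t. leaves_of_type S \<F> t \<noteq> {}} \<ge> 2 \<and>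
      (\<forall>t. leaves_of_type S \<F> t \<noteq> {} \<longrightarrow>
         (top_of_set S) closure_of (\<Union>(leaves_of_type S \<F> t)) = S))"

end

theory Submission
  imports Defs
begin

text \<open>
  The example is a surface on which a foliation with all leaves dense has been cut open along a
  closed set that meets only countably many leaves.

  Take an upper triangle over the interval \<open>(-1/2, 1/2)\<close> and two lower triangles over
  \<open>(-1/2, a - 1/2)\<close> and \<open>(a - 1/2, 1/2)\<close>, where \<open>a\<close> is irrational. Foliate each triangle with
  centre \<open>c\<close> by the tents \<open>\<bar>x - c\<bar> + \<bar>y\<bar> = const\<close>. An upper tent joins \<open>t\<close> to \<open>-t\<close>, a lower tent
  joins \<open>t\<close> to \<open>a - t\<close> modulo 1; following one after the other is the rotation by \<open>a\<close> of the circle.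
  The holonomy is therefore that of the foliation on the sphere with four thorns which is covered by
  an irrational linear foliation of the torus. Such a non-orientable foliation is needed, because by
  the Jordan curve theorem an orientable foliation of a planar surface has only proper leaves.

  Now glue the triangles only along the complement \<open>G\<close> of a closed set \<open>B\<close> of walls on the axis.
  A leaf is a chain of tents, the end points of which run through an orbit of the rotation, and the
  chain stops where the orbit meets \<open>B\<close>. If it stops on both sides, then the leaf is a finite union
  of tents, so it meets every chart in finitely many plaques; this makes it proper and nowhere
  dense. Otherwise it contains half an orbit of an irrational rotation, and Kronecker's theorem makes
  it dense. This dichotomy is \<open>leaf_dichotomy\<close>.

  It remains to choose \<open>B\<close>. Besides the centres and corners of the triangles it contains the
  points \<open>k\<^sub>n a\<close> modulo 1 for some sequence \<open>k\<^sub>n \<rightarrow> \<infinity>\<close> with \<open>k\<^sub>n a \<rightarrow> 0\<close> modulo 1, so that \<open>B\<close> is closed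
  and countable. Every tent ending at a point \<open>k a\<close> with \<open>k \<ge> 1\<close> then lies between the walls \<open>0\<close>
  and \<open>k\<^sub>n a\<close> of the same orbit, hence in a finite leaf, and these tents are dense. A leaf whose orbit
  avoids the countable set \<open>B\<close> is dense. Hence the proper leaves and the locally dense leaves both
  have a dense union and there are no exceptional leaves. If the union of the locally dense leaves
  were open, it would meet one of the finite leaves, which are not locally dense.
\<close>

section \<open>Leaves, plaques and saturated sets\<close>

text \<open>
  A set of points that is a union of plaques. Leaves are saturated, and saturated sets are clopen in
  the leaf topology; this is how leaves are computed without describing them completely.
\<close>

definition saturated :: "'a chart set \<Rightarrow> 'a set \<Rightarrow> bool" where
  "saturated \<F> A \<longleftrightarrow>
     (\<forall>(U, \<phi>)\<in>\<F>. \<forall>p\<in>U. \<forall>q\<in>U. snd (\<phi> p) = snd (\<phi> q) \<longrightarrow> (p \<in> A \<longleftrightarrow> q \<in> A))"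

lemma saturatedD:
  assumes "saturated \<F> A" "(U, \<phi>) \<in> \<F>" "p \<in> U" "q \<in> U" "snd (\<phi> p) = snd (\<phi> q)" "p \<in> A"
  shows "q \<in> A"
  using assms unfolding saturated_def by blast

context
  fixes S :: "'a::topological_space set" and \<F> :: "'a chart set"
  assumes fol: "codim_one_foliation S \<F>"
begin

lemma chart_subset: "(U, \<phi>) \<in> \<F> \<Longrightarrow> U \<subseteq> S"
  using fol unfolding codim_one_foliation_def by force

lemma chart_open: "(U, \<phi>) \<in> \<F> \<Longrightarrow> openin (top_of_set S) U"
  using fol unfolding codim_one_foliation_def foliated_chart_def by fastforce

lemma chart_homeomorphism:
  assumes "(U, \<phi>) \<in> \<F>"
  obtains I J \<psi> where "open I" "connected I" "open J" "homeomorphism U (I \<times> J) \<phi> \<psi>"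
proof -
  have "foliated_chart S (U, \<phi>)"
    using fol assms unfolding codim_one_foliation_def by blast
  then show ?thesis
    using that unfolding foliated_chart_def prod.case by blast
qed

lemma chart_at:
  assumes "p \<in> S" obtains U \<phi> where "(U, \<phi>) \<in> \<F>" "p \<in> U"
  using fol assms unfolding codim_one_foliation_def by fastforce

lemma charts_compatible:
  assumes "(U, \<phi>) \<in> \<F>" "(V, \<xi>) \<in> \<F>" "p \<in> U" "p \<in> V"
  obtains W h where "openin (top_of_set S) W" "p \<in> W" "W \<subseteq> U \<inter> V"
    "\<And>q. q \<in> W \<Longrightarrow> snd (\<xi> q) = h (snd (\<phi> q))"
proof -
  have "foliated_compatible S (U, \<phi>) (V, \<xi>)"
    using fol assms unfolding codim_one_foliation_def by blast
  then have "\<exists>W g h. openin (top_of_set S) W \<and> p \<in> W \<and> W \<subseteq> U \<inter> V \<and>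
       (\<forall>q\<in>W. \<xi> q = (g (\<phi> q), h (snd (\<phi> q))))"
    using assms unfolding foliated_compatible_def by blast
  then show ?thesis
    using that by force
qed

lemma topspace_leaf_topology: "topspace (leaf_topology S \<F>) = S"
proof -
  have "S \<subseteq> \<Union>{W \<inter> P |W P. openin (top_of_set S) W \<and> P \<in> plaques \<F>}"
  proof
    fix p assume p: "p \<in> S"
    obtain U \<phi> where U: "(U, \<phi>) \<in> \<F>" "p \<in> U"
      using chart_at[OF p] .
    let ?P = "{q \<in> U. snd (\<phi> q) = snd (\<phi> p)}"
    have P: "?P \<in> plaques \<F>"
      using U unfolding plaques_def by blast
    show "p \<in> \<Union>{W \<inter> P |W P. openin (top_of_set S) W \<and> P \<in> plaques \<F>}"
    proof (rule UnionI)
      show "S \<inter> ?P \<in> {W \<inter> P |W P. openin (top_of_set S) W \<and> P \<in> plaques \<F>}"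
        using P openin_subtopology_self by blast
    qed (use p U in auto)
  qed
  moreover have "\<Union>{W \<inter> P |W P. openin (top_of_set S) W \<and> P \<in> plaques \<F>} \<subseteq> S"
    by (auto dest: openin_imp_subset)
  ultimately show ?thesis
    unfolding leaf_topology_def topology_generated_by_topspace by (intro equalityI)
qed

lemma openin_leaf_topology_Int_plaque:
  assumes "openin (top_of_set S) W" "(U, \<phi>) \<in> \<F>" "p \<in> U"
  shows "openin (leaf_topology S \<F>) (W \<inter> {q \<in> U. snd (\<phi> q) = snd (\<phi> p)})"
proof -
  have "{q \<in> U. snd (\<phi> q) = snd (\<phi> p)} \<in> plaques \<F>"
    using assms(2,3) unfolding plaques_def by blast
  then show ?thesis
    unfolding leaf_topology_def using assms(1) by (intro topology_generated_by_Basis) blast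
qed

text \<open>
  Plaques are open in the leaf topology.
\<close>

lemma saturated_openin:
  assumes "A \<subseteq> S" "saturated \<F> A"
  shows "openin (leaf_topology S \<F>) A"
proof (subst openin_subopen, intro ballI)
  fix p assume p: "p \<in> A"
  then obtain U \<phi> where U: "(U, \<phi>) \<in> \<F>" "p \<in> U"
    using chart_at assms by blast
  have "openin (leaf_topology S \<F>) (S \<inter> {q \<in> U. snd (\<phi> q) = snd (\<phi> p)})"
    using U by (intro openin_leaf_topology_Int_plaque) auto
  moreover have "S \<inter> {q \<in> U. snd (\<phi> q) = snd (\<phi> p)} \<subseteq> A"
    using saturatedD[OF assms(2) U(1,2)] p by auto
  ultimately show "\<exists>N. openin (leaf_topology S \<F>) N \<and> p \<in> N \<and> N \<subseteq> A"
    using p U assms(1) by (intro exI[of _ "S \<inter> {q \<in> U. snd (\<phi> q) = snd (\<phi> p)}"]) blast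
qed

lemma saturated_closedin:
  assumes "A \<subseteq> S" "saturated \<F> A"
  shows "closedin (leaf_topology S \<F>) A"
proof -
  have "saturated \<F> (S - A)"
    using assms(2) chart_subset unfolding saturated_def by blast
  then show ?thesis
    using assms(1) saturated_openin[of "S - A"] by (simp add: closedin_def topspace_leaf_topology)
qed

text \<open>
  A plaque is the image of an interval under the inverse chart with fixed transverse coordinate.
  That map is continuous into the finer leaf topology: where the plaque meets a second chart, the
  transverse coordinate of the second chart depends only on that of the first, so it is locally
  constant along the plaque.
\<close>

lemma plaque_connectedin:
  assumes U: "(U, \<phi>) \<in> \<F>" and p: "p \<in> U"
  shows "connectedin (leaf_topology S \<F>) {q \<in> U. snd (\<phi> q) = snd (\<phi> p)}"
proof -
  obtain I J \<psi> where I: "connected I" and hom: "homeomorphism U (I \<times> J) \<phi> \<psi>"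
    using chart_homeomorphism[OF U] by metis
  define y where "y = snd (\<phi> p)"
  define \<gamma> where "\<gamma> t = \<psi> (t, y)" for t
  have "\<phi> p \<in> I \<times> J"
    using hom p unfolding homeomorphism_def by blast
  then have y: "y \<in> J"
    unfolding y_def by (auto simp: mem_Times_iff)
  have \<gamma>: "\<gamma> t \<in> U" "\<phi> (\<gamma> t) = (t, y)" if "t \<in> I" for t
    using hom y that unfolding homeomorphism_def \<gamma>_def by auto
  have cont: "continuous_on I \<gamma>"
    using continuous_on_compose2[OF homeomorphism_cont2[OF hom], of I "\<lambda>t. (t, y)"] y
    unfolding \<gamma>_def by (simp add: continuous_on_Pair image_subset_iff)
  have img: "\<gamma> ` I = {q \<in> U. snd (\<phi> q) = y}"
  proof (intro equalityI subsetI)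
    fix q assume q: "q \<in> {q \<in> U. snd (\<phi> q) = y}"
    then have "\<phi> q \<in> I \<times> J" "\<psi> (\<phi> q) = q"
      using hom unfolding homeomorphism_def by blast+
    then show "q \<in> \<gamma> ` I"
      using q unfolding \<gamma>_def by (intro image_eqI[of _ _ "fst (\<phi> q)"]) (auto simp: mem_Times_iff)
  qed (use \<gamma> in auto)
  have "continuous_map (top_of_set I) (leaf_topology S \<F>) \<gamma>"
    unfolding leaf_topology_def continuous_on_generated_topo_iff
  proof (intro conjI allI impI)
    fix Q assume "Q \<in> {W \<inter> P |W P. openin (top_of_set S) W \<and> P \<in> plaques \<F>}"
    then obtain W V \<xi> z where W: "openin (top_of_set S) W" and V: "(V, \<xi>) \<in> \<F>"
      and Q: "Q = W \<inter> {q \<in> V. snd (\<xi> q) = z}"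
      unfolding plaques_def by blast
    show "openin (top_of_set I) (\<gamma> -` Q \<inter> topspace (top_of_set I))"
    proof (subst openin_subopen, intro ballI)
      fix t assume t: "t \<in> \<gamma> -` Q \<inter> topspace (top_of_set I)"
      then have tI: "t \<in> I" and tQ: "\<gamma> t \<in> W" "\<gamma> t \<in> V" "snd (\<xi> (\<gamma> t)) = z"
        using Q by auto
      obtain W1 h where W1: "openin (top_of_set S) W1" "\<gamma> t \<in> W1" "W1 \<subseteq> U \<inter> V"
          and h: "\<And>q. q \<in> W1 \<Longrightarrow> snd (\<xi> q) = h (snd (\<phi> q))"
        using charts_compatible[OF U V \<gamma>(1)[OF tI] tQ(2)] by blast
      have hz: "h y = z"
        using h[OF W1(2)] tQ(3) \<gamma>(2)[OF tI] by simp
      have "openin (top_of_set I) (I \<inter> \<gamma> -` (W \<inter> W1))"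
        by (rule continuous_openin_preimage[OF cont, of S])
           (use \<gamma> chart_subset[OF U] W W1 in \<open>auto\<close>)
      moreover have "I \<inter> \<gamma> -` (W \<inter> W1) \<subseteq> \<gamma> -` Q \<inter> topspace (top_of_set I)"
        using h \<gamma> hz W1(3) unfolding Q by fastforce
      ultimately show "\<exists>N. openin (top_of_set I) N \<and> t \<in> N \<and>
          N \<subseteq> \<gamma> -` Q \<inter> topspace (top_of_set I)"
        using tI tQ W1(2) by blast
    qed
  next
    have "\<gamma> ` I \<subseteq> topspace (leaf_topology S \<F>)"
      using \<gamma> chart_subset[OF U] by (auto simp: topspace_leaf_topology)
    then show "\<gamma> ` topspace (top_of_set I) \<subseteq>
        \<Union>{W \<inter> P |W P. openin (top_of_set S) W \<and> P \<in> plaques \<F>}"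
      unfolding leaf_topology_def topology_generated_by_topspace by simp
  qed
  then have "connectedin (leaf_topology S \<F>) (\<gamma> ` I)"
    by (rule connectedin_continuous_map_image) (use I in \<open>simp add: connectedin_subtopology\<close>)
  then show ?thesis
    using img y_def by simp
qed

lemma leaf_through:
  assumes "p \<in> S" obtains L where "L \<in> leaves S \<F>" "p \<in> L"
proof -
  have "p \<in> \<Union>(connected_components_of (leaf_topology S \<F>))"
    using assms by (simp only: Union_connected_components_of topspace_leaf_topology)
  then show ?thesis
    using that unfolding leaves_def by blast
qed

lemma leaf_nonempty_subset:
  assumes "L \<in> leaves S \<F>" shows "L \<noteq> {}" "L \<subseteq> S"
  using connected_components_of_subset[of L "leaf_topology S \<F>"]
    nonempty_connected_components_of[of L "leaf_topology S \<F>"] assms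
  by (simp_all only: leaves_def topspace_leaf_topology simp_thms)

lemma leaf_eq:
  assumes "L \<in> leaves S \<F>" "L' \<in> leaves S \<F>" "p \<in> L" "p \<in> L'" shows "L = L'"
  using connected_components_of_overlap[of L "leaf_topology S \<F>" L'] assms
  unfolding leaves_def by auto

lemma leaf_saturated: 
  assumes "L \<in> leaves S \<F>" shows "saturated \<F> L"
proof -
  have "q \<in> L" if "(U, \<phi>) \<in> \<F>" "p \<in> U" "q \<in> U" "snd (\<phi> p) = snd (\<phi> q)" "p \<in> L" for U \<phi> p q
  proof -
    have "{q \<in> U. snd (\<phi> q) = snd (\<phi> p)} \<subseteq> L"
      by (rule connected_components_of_maximal[OF _ plaque_connectedin[OF that(1,2)]])
         (use assms that in \<open>auto simp: leaves_def disjnt_iff\<close>)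
    then show ?thesis
      using that by auto
  qed
  note plaque = this
  show ?thesis
    unfolding saturated_def
  proof clarify
    fix U \<phi> p q
    assume "(U, \<phi>) \<in> \<F>" "p \<in> U" "q \<in> U" "snd (\<phi> p) = snd (\<phi> q)"
    then show "p \<in> L \<longleftrightarrow> q \<in> L"
      using plaque[of U \<phi> p q] plaque[of U \<phi> q p] by auto
  qed
qed

text \<open>
  This bounds a leaf from above: it suffices to find some saturated set through one of its points.
\<close>

lemma leaf_subset_saturated:
  assumes "L \<in> leaves S \<F>" "p \<in> L" "p \<in> A" "A \<subseteq> S" "saturated \<F> A"
  shows "L \<subseteq> A"
proof -
  have "connectedin (leaf_topology S \<F>) L"
    using assms(1) unfolding leaves_def by (rule connectedin_connected_components_of)
  then have "L \<subseteq> A \<or> disjnt L A"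
    by (rule connectedin_clopen_cases[OF _ saturated_closedin saturated_openin]) (use assms in auto)
  then show ?thesis
    using assms(2,3) by (auto simp: disjnt_iff)
qed

lemma continuous_map_leaf_topology: "continuous_map (leaf_topology S \<F>) (top_of_set S) (\<lambda>p. p)"
  unfolding continuous_map
proof (intro conjI allI impI)
  fix W assume W: "openin (top_of_set S) W"
  have "openin (leaf_topology S \<F>) W"
  proof (subst openin_subopen, intro ballI)
    fix p assume p: "p \<in> W"
    then obtain U \<phi> where U: "(U, \<phi>) \<in> \<F>" "p \<in> U"
      using chart_at openin_imp_subset[OF W] by blast
    show "\<exists>N. openin (leaf_topology S \<F>) N \<and> p \<in> N \<and> N \<subseteq> W"
      using openin_leaf_topology_Int_plaque[OF W U] p U by blast
  qed
  moreover have "{x \<in> topspace (leaf_topology S \<F>). x \<in> W} = W"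
    using openin_imp_subset[OF W] by (auto simp: topspace_leaf_topology)
  ultimately show "openin (leaf_topology S \<F>) {x \<in> topspace (leaf_topology S \<F>). x \<in> W}"
    by simp
qed (simp add: topspace_leaf_topology)

lemma leaf_connected:
  assumes "L \<in> leaves S \<F>" shows "connected L"
proof -
  have "connectedin (leaf_topology S \<F>) L"
    using assms unfolding leaves_def by (rule connectedin_connected_components_of)
  then have "connectedin (top_of_set S) ((\<lambda>p. p) ` L)"
    by (rule connectedin_continuous_map_image[OF continuous_map_leaf_topology])
  then show ?thesis
    by (simp only: image_ident connectedin_subtopology connectedin_iff_connected)
qed

text \<open>
  When a leaf has finitely many plaques in a chart, the other plaques can be separated from a given
  one by an open condition on the transverse coordinate. So the plaque is open in the leaf for the
  topology of the surface, and the two topologies agree on the leaf.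
\<close>

lemma finite_traces_proper:
  assumes L: "L \<in> leaves S \<F>" and fin: "\<And>U \<phi>. (U, \<phi>) \<in> \<F> \<Longrightarrow> finite (snd ` \<phi> ` (L \<inter> U))"
  shows "proper_leaf S \<F> L"
proof -
  have LS: "L \<subseteq> S"
    by (rule leaf_nonempty_subset(2)[OF L])
  let ?X = "subtopology (leaf_topology S \<F>) L"
  have cont: "continuous_map ?X (top_of_set L) (\<lambda>p. p)"
    using continuous_map_from_subtopology[OF continuous_map_leaf_topology, of L] LS
    by (auto simp: continuous_map_in_subtopology topspace_leaf_topology)
  have sub: "subtopology (top_of_set S) L = top_of_set L"
    using LS by (simp add: subtopology_subtopology inf.absorb2)
  have "continuous_map (top_of_set L) (leaf_topology S \<F>) (\<lambda>p. p)"
    unfolding leaf_topology_def continuous_on_generated_topo_iff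
  proof (intro conjI allI impI)
    fix Q assume "Q \<in> {W \<inter> P |W P. openin (top_of_set S) W \<and> P \<in> plaques \<F>}"
    then obtain W U \<phi> y where W: "openin (top_of_set S) W" and U: "(U, \<phi>) \<in> \<F>"
      and Q: "Q = W \<inter> {q \<in> U. snd (\<phi> q) = y}"
      unfolding plaques_def by blast
    obtain I J \<psi> where hom: "homeomorphism U (I \<times> J) \<phi> \<psi>"
      using chart_homeomorphism[OF U] by metis
    \<comment> \<open>The transverse coordinates of the other plaques of the leaf in this chart.\<close>
    define F where "F = snd ` \<phi> ` (L \<inter> U) - {y}"
    have "continuous_on U (\<lambda>q. snd (\<phi> q))"
      using homeomorphism_cont1[OF hom] by (intro continuous_intros)
    moreover have "finite F"
      using fin[OF U] unfolding F_def by simp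
    then have "open (- F)"
      by (simp add: finite_imp_closed open_Compl)
    ultimately have "openin (top_of_set U) (U \<inter> (\<lambda>q. snd (\<phi> q)) -` (- F))"
      by (rule continuous_openin_preimage_gen)
    then have "openin (top_of_set S) (U \<inter> (\<lambda>q. snd (\<phi> q)) -` (- F))"
      using chart_open[OF U] openin_trans by blast
    then have "openin (top_of_set S) (W \<inter> (U \<inter> (\<lambda>q. snd (\<phi> q)) -` (- F)))"
      using W by blast
    then have "openin (subtopology (top_of_set S) L) (L \<inter> (W \<inter> (U \<inter> (\<lambda>q. snd (\<phi> q)) -` (- F))))"
      by (rule openin_subtopology_Int2)
    moreover have "L \<inter> (W \<inter> (U \<inter> (\<lambda>q. snd (\<phi> q)) -` (- F))) = (\<lambda>p. p) -` Q \<inter> topspace (top_of_set L)"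
      unfolding Q F_def by auto
    ultimately show "openin (top_of_set L) ((\<lambda>p. p) -` Q \<inter> topspace (top_of_set L))"
      unfolding sub by simp
  next
    show "(\<lambda>p. p) ` topspace (top_of_set L) \<subseteq>
        \<Union>{W \<inter> P |W P. openin (top_of_set S) W \<and> P \<in> plaques \<F>}"
      using LS topspace_leaf_topology unfolding leaf_topology_def topology_generated_by_topspace by auto
  qed
  then have "continuous_map (top_of_set L) ?X (\<lambda>p. p)"
    by (auto simp: continuous_map_in_subtopology)
  with cont have "homeomorphic_map ?X (top_of_set L) (\<lambda>p. p)"
    unfolding homeomorphic_map_maps homeomorphic_maps_def by auto
  moreover have "(\<lambda>p. p) ` topspace ?X = L"
    using LS by (auto simp: topspace_leaf_topology)
  ultimately show ?thesis
    unfolding proper_leaf_def embedding_map_def by (simp add: sub)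
qed

text \<open>
  In a chart, the closure of such a leaf stays in finitely many horizontal lines, whereas an open set
  has an open projection to the transverse coordinate.
\<close>

lemma finite_traces_not_locally_dense:
  assumes L: "L \<in> leaves S \<F>" and fin: "\<And>U \<phi>. (U, \<phi>) \<in> \<F> \<Longrightarrow> finite (snd ` \<phi> ` (L \<inter> U))"
  shows "\<not> locally_dense_leaf S L"
proof
  assume "locally_dense_leaf S L"
  then obtain p where "p \<in> (top_of_set S) interior_of ((top_of_set S) closure_of L)"
    unfolding locally_dense_leaf_def by blast
  then obtain O' where O': "openin (top_of_set S) O'" "p \<in> O'" "O' \<subseteq> (top_of_set S) closure_of L"
    unfolding interior_of_def by blast
  then obtain U \<phi> where U: "(U, \<phi>) \<in> \<F>" "p \<in> U"
    using chart_at openin_imp_subset by blast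
  obtain I J \<psi> where I: "open I" "open J" and hom: "homeomorphism U (I \<times> J) \<phi> \<psi>"
    using chart_homeomorphism[OF U(1)] by metis
  define F where "F = snd ` \<phi> ` (L \<inter> U)"
  have cont: "continuous_on U (\<lambda>q. snd (\<phi> q))"
    using homeomorphism_cont1[OF hom] by (intro continuous_intros)
  have inF: "snd (\<phi> q) \<in> F" if q: "q \<in> O' \<inter> U" for q
  proof (rule ccontr)
    assume nF: "snd (\<phi> q) \<notin> F"
    have "open (- F)"
      using fin[OF U(1)] unfolding F_def by (simp add: finite_imp_closed open_Compl)
    with cont have "openin (top_of_set U) (U \<inter> (\<lambda>q. snd (\<phi> q)) -` (- F))"
      by (rule continuous_openin_preimage_gen)
    then have N: "openin (top_of_set S) (U \<inter> (\<lambda>q. snd (\<phi> q)) -` (- F))"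
      using chart_open[OF U(1)] by (rule openin_trans)
    have "q \<in> (top_of_set S) closure_of L" "q \<in> U \<inter> (\<lambda>q. snd (\<phi> q)) -` (- F)"
      using q O'(3) nF by auto
    then have "\<exists>z\<in>L. z \<in> U \<inter> (\<lambda>q. snd (\<phi> q)) -` (- F)"
      using N unfolding in_closure_of by metis
    then show False
      unfolding F_def by auto
  qed
  have "openin (top_of_set U) (O' \<inter> U)"
    by (rule openin_subset_trans[OF openin_Int[OF O'(1) chart_open[OF U(1)]]])
       (use chart_subset[OF U(1)] in auto)
  then have "openin (top_of_set (I \<times> J)) (\<phi> ` (O' \<inter> U))"
    by (rule homeomorphism_imp_open_map[OF hom])
  then have "open (\<phi> ` (O' \<inter> U))"
    using openin_open_eq[OF open_Times[OF I]] by simp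
  then have "open (snd ` \<phi> ` (O' \<inter> U))"
    by (rule open_image_snd)
  moreover have "snd ` \<phi> ` (O' \<inter> U) \<subseteq> F"
    using inF by blast
  moreover have "finite F"
    using fin[OF U(1)] F_def by simp
  ultimately have "snd ` \<phi> ` (O' \<inter> U) = {}"
    using finite_imp_not_open[OF finite_subset] by metis
  then show False
    using O'(2) U(2) by auto
qed

end

section \<open>Surfaces glued from triangles that are foliated by tents\<close>

text \<open>
  The first coordinate of a change of charts may depend on everything, so only the transverse
  coordinate has to be checked.
\<close>

lemma foliated_compatibleI:
  assumes chart: "foliated_chart S (U, \<phi>)"
    and "\<And>p. p \<in> U \<Longrightarrow> p \<in> V \<Longrightarrow> \<exists>W h. openin (top_of_set S) W \<and> p \<in> W \<and> W \<subseteq> U \<inter> V \<and>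
           (\<forall>q\<in>W. snd (\<xi> q) = h (snd (\<phi> q)))"
  shows "foliated_compatible S (U, \<phi>) (V, \<xi>)"
  unfolding foliated_compatible_def prod.case
proof
  fix p assume p: "p \<in> U \<inter> V"
  have "\<exists>W h. openin (top_of_set S) W \<and> p \<in> W \<and> W \<subseteq> U \<inter> V \<and>
      (\<forall>q\<in>W. snd (\<xi> q) = h (snd (\<phi> q)))"
    by (rule assms(2)) (use p in auto)
  then obtain W h where W: "openin (top_of_set S) W" "p \<in> W" "W \<subseteq> U \<inter> V"
    and h: "\<forall>q\<in>W. snd (\<xi> q) = h (snd (\<phi> q))"
    by metis
  obtain I J \<psi> where "homeomorphism U (I \<times> J) \<phi> \<psi>"
    using chart unfolding foliated_chart_def prod.case by blast
  then have "\<forall>q\<in>W. \<psi> (\<phi> q) = q"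
    using W(3) homeomorphism_apply1 by fastforce
  then have "\<forall>q\<in>W. \<xi> q = ((fst \<circ> \<xi> \<circ> \<psi>) (\<phi> q), h (snd (\<phi> q)))"
    using h by (simp add: prod_eq_iff)
  with W show "\<exists>W g h. openin (top_of_set S) W \<and> p \<in> W \<and> W \<subseteq> U \<inter> V \<and>
      (\<forall>q\<in>W. \<xi> q = (g (\<phi> q), h (snd (\<phi> q))))"
    by (intro exI conjI)
qed

text \<open>
  The open triangle with base \<open>(c - r, c + r)\<close> on the axis, above it for \<open>\<sigma> = 1\<close> and below it for
  \<open>\<sigma> = -1\<close>. Tents have straight sides, which keeps all the charts piecewise rational; with the
  Euclidean norm they would be half circles.
\<close>

definition tent_region :: "real \<Rightarrow> real \<Rightarrow> real \<Rightarrow> (real \<times> real) set" where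
  "tent_region c r \<sigma> = {p. 0 < \<sigma> * snd p \<and> \<bar>fst p - c\<bar> + \<bar>snd p\<bar> < r}"

text \<open>
  The right end point, on the axis, of the tent through \<open>p\<close>. It serves as the transverse coordinate.
\<close>

definition tent_end :: "real \<Rightarrow> real \<times> real \<Rightarrow> real" where
  "tent_end c p = c + \<bar>fst p - c\<bar> + \<bar>snd p\<bar>"

definition tent_map :: "real \<Rightarrow> real \<times> real \<Rightarrow> real \<times> real" where
  "tent_map c p = ((fst p - c) / (\<bar>fst p - c\<bar> + \<bar>snd p\<bar>), tent_end c p)"

text \<open>
  Near the axis the leaves are segments of slope \<open>\<plusminus>1\<close>, and this is the point where the segment
  through \<open>p\<close> crosses the axis. The function \<open>s\<close> gives, for the upper side \<open>1\<close> and the lower side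
  \<open>-1\<close>, on which side of the centre of the triangle the point lies.
\<close>

definition crossing :: "(real \<Rightarrow> real) \<Rightarrow> real \<times> real \<Rightarrow> real" where
  "crossing s p = fst p + s 1 * max (snd p) 0 + s (-1) * max (- snd p) 0"

definition gate_box :: "real \<Rightarrow> real \<Rightarrow> (real \<Rightarrow> real) \<Rightarrow> (real \<times> real) set" where
  "gate_box x e s = {p. \<bar>snd p\<bar> < e \<and> \<bar>crossing s p - x\<bar> < e}"

definition box_map :: "(real \<Rightarrow> real) \<Rightarrow> real \<times> real \<Rightarrow> real \<times> real" where
  "box_map s p = (snd p, crossing s p)"

lemma open_tent_region: "open (tent_region c r \<sigma>)"
  unfolding tent_region_def by (intro open_Collect_conj open_Collect_less continuous_intros)

lemma continuous_on_crossing: "continuous_on A (crossing s)"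
  unfolding crossing_def by (intro continuous_intros)

lemma open_box: "open (gate_box x e s)"
  unfolding gate_box_def
  by (intro open_Collect_conj open_Collect_less continuous_intros continuous_on_crossing)

lemma tent_homeomorphism:
  assumes \<sigma>: "\<sigma> = 1 \<or> \<sigma> = (-1::real)"
  shows "homeomorphism (tent_region c r \<sigma>) ({-1<..<1} \<times> {c<..<c + r}) (tent_map c)
           (\<lambda>(u, t). (c + u * (t - c), \<sigma> * (t - c) * (1 - \<bar>u\<bar>)))"
proof (rule homeomorphismI)
  have pos: "0 < \<bar>fst p - c\<bar> + \<bar>snd p\<bar>" if "p \<in> tent_region c r \<sigma>" for p
    using that \<sigma> unfolding tent_region_def by auto
  show "continuous_on (tent_region c r \<sigma>) (tent_map c)"
    unfolding tent_map_def tent_end_def using pos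
    by (intro continuous_intros) fastforce
  show "continuous_on ({-1<..<1} \<times> {c<..<c + r})
      (\<lambda>(u, t). (c + u * (t - c), \<sigma> * (t - c) * (1 - \<bar>u\<bar>)))"
    unfolding case_prod_unfold by (intro continuous_intros)
  show "tent_map c ` tent_region c r \<sigma> \<subseteq> {-1<..<1} \<times> {c<..<c + r}"
  proof (rule image_subsetI)
    fix p assume p: "p \<in> tent_region c r \<sigma>"
    have "snd p \<noteq> 0"
      using p unfolding tent_region_def by auto
    then have "-1 < (fst p - c) / (\<bar>fst p - c\<bar> + \<bar>snd p\<bar>)" "(fst p - c) / (\<bar>fst p - c\<bar> + \<bar>snd p\<bar>) < 1"
      using pos[OF p] by (auto simp: less_divide_eq divide_less_eq)
    then show "tent_map c p \<in> {-1<..<1} \<times> {c<..<c + r}"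
      using p pos[OF p] unfolding tent_map_def tent_end_def tent_region_def by auto
  qed
  have tent: "\<bar>u * (t - c :: real)\<bar> + \<bar>\<sigma> * (t - c) * (1 - \<bar>u\<bar>)\<bar> = t - c"
    if "-1 < (u::real)" "u < 1" "c < t" for u t
  proof -
    have "\<bar>u * (t - c)\<bar> = \<bar>u\<bar> * (t - c)" "\<bar>\<sigma> * (t - c) * (1 - \<bar>u\<bar>)\<bar> = (t - c) * (1 - \<bar>u\<bar>)"
      using \<sigma> that by (auto simp: abs_mult)
    then show ?thesis
      by (simp add: algebra_simps)
  qed
  show "(\<lambda>(u, t). (c + u * (t - c), \<sigma> * (t - c) * (1 - \<bar>u\<bar>))) ` ({-1<..<1} \<times> {c<..<c + r})
      \<subseteq> tent_region c r \<sigma>"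
  proof (rule image_subsetI, unfold case_prod_unfold)
    fix v :: "real \<times> real" assume v: "v \<in> {-1<..<1} \<times> {c<..<c + r}"
    define u t where "u = fst v" and "t = snd v"
    have ut: "-1 < u" "u < 1" "c < t" "t < c + r"
      using v unfolding u_def t_def by auto
    have "\<sigma> * (\<sigma> * (t - c) * (1 - \<bar>u\<bar>)) = (t - c) * (1 - \<bar>u\<bar>)"
      using \<sigma> by auto
    moreover have "0 < (t - c) * (1 - \<bar>u\<bar>)"
      using ut by simp
    ultimately have "0 < \<sigma> * (\<sigma> * (t - c) * (1 - \<bar>u\<bar>))"
      by (simp only:)
    then have "(c + u * (t - c), \<sigma> * (t - c) * (1 - \<bar>u\<bar>)) \<in> tent_region c r \<sigma>"
      using tent[of u t] ut unfolding tent_region_def by simp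
    then show "(c + fst v * (snd v - c), \<sigma> * (snd v - c) * (1 - \<bar>fst v\<bar>)) \<in> tent_region c r \<sigma>"
      unfolding u_def t_def .
  qed
  show "(\<lambda>(u, t). (c + u * (t - c), \<sigma> * (t - c) * (1 - \<bar>u\<bar>))) (tent_map c p) = p"
    if p: "p \<in> tent_region c r \<sigma>" for p
  proof -
    define d where "d = \<bar>fst p - c\<bar> + \<bar>snd p\<bar>"
    have d: "0 < d"
      using pos[OF p] unfolding d_def .
    have "d * (1 - \<bar>(fst p - c) / d\<bar>) = \<bar>snd p\<bar>"
      using d by (simp add: abs_divide right_diff_distrib) (simp add: d_def)
    moreover have "\<sigma> * \<bar>snd p\<bar> = snd p"
      using p \<sigma> unfolding tent_region_def by auto
    ultimately have "\<sigma> * d * (1 - \<bar>(fst p - c) / d\<bar>) = snd p"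
      by (simp add: mult.assoc)
    moreover have "tent_end c p = c + d"
      unfolding tent_end_def d_def by simp
    ultimately show ?thesis
      using d unfolding tent_map_def d_def[symmetric] by (simp add: prod_eq_iff)
  qed
  show "tent_map c ((\<lambda>(u, t). (c + u * (t - c), \<sigma> * (t - c) * (1 - \<bar>u\<bar>))) v) = v"
    if v: "v \<in> {-1<..<1} \<times> {c<..<c + r}" for v
    using v tent[of "fst v" "snd v"]
    by (auto simp: tent_map_def tent_end_def case_prod_unfold)
qed

lemma box_homeomorphism:
  "homeomorphism (gate_box x e s) ({-e<..<e} \<times> {x - e<..<x + e}) (box_map s)
     (\<lambda>(y, t). (t - s 1 * max y 0 - s (-1) * max (- y) 0, y))"
proof (rule homeomorphismI)
  show "continuous_on (gate_box x e s) (box_map s)"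
    unfolding box_map_def by (intro continuous_intros continuous_on_crossing)
  show "continuous_on ({-e<..<e} \<times> {x - e<..<x + e})
      (\<lambda>(y, t). (t - s 1 * max y 0 - s (-1) * max (- y) 0, y))"
    unfolding case_prod_unfold by (intro continuous_intros)
qed (auto simp: gate_box_def box_map_def crossing_def abs_less_iff)

lemma crossing_side:
  assumes "\<sigma> = 1 \<or> \<sigma> = (-1::real)" "0 \<le> \<sigma> * snd p"
  shows "crossing s p = fst p + s \<sigma> * \<bar>snd p\<bar>"
  using assms unfolding crossing_def by auto

lemma foliated_chart_tent_region:
  assumes "\<sigma> = 1 \<or> \<sigma> = (-1::real)" "0 < r" "tent_region c r \<sigma> \<subseteq> S"
  shows "foliated_chart S (tent_region c r \<sigma>, tent_map c)"
  unfolding foliated_chart_def prod.case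
proof (intro conjI exI)
  show "openin (top_of_set S) (tent_region c r \<sigma>)"
    using assms(3) open_tent_region by (simp add: open_subset)
  show "homeomorphism (tent_region c r \<sigma>) ({-1<..<1} \<times> {c<..<c + r}) (tent_map c)
           (\<lambda>(u, t). (c + u * (t - c), \<sigma> * (t - c) * (1 - \<bar>u\<bar>)))"
    by (rule tent_homeomorphism[OF assms(1)])
qed (use assms(2) in auto)

lemma foliated_chart_box:
  assumes "0 < e" "gate_box x e s \<subseteq> S"
  shows "foliated_chart S (gate_box x e s, box_map s)"
  unfolding foliated_chart_def prod.case
proof (intro conjI exI)
  show "openin (top_of_set S) (gate_box x e s)"
    using assms(2) open_box by (simp add: open_subset)
  show "homeomorphism (gate_box x e s) ({-e<..<e} \<times> {x - e<..<x + e}) (box_map s)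
     (\<lambda>(y, t). (t - s 1 * max y 0 - s (-1) * max (- y) 0, y))"
    by (rule box_homeomorphism)
qed (use assms(1) in auto)

text \<open>
  Triangles \<open>(c, r, \<sigma>)\<close> on the two sides of the axis, glued along an open set \<open>G\<close> of gates. A gate
  must not be the centre of a triangle: there the tents shrink to a point and the foliation has a
  thorn.
\<close>

locale tent_pattern =
  fixes T :: "(real \<times> real \<times> real) set" and G :: "real set"
  assumes side: "(c, r, \<sigma>) \<in> T \<Longrightarrow> \<sigma> = 1 \<or> \<sigma> = -1"
    and radius: "(c, r, \<sigma>) \<in> T \<Longrightarrow> 0 < r"
    and disjoint_bases: "(c, r, \<sigma>) \<in> T \<Longrightarrow> (c', r', \<sigma>) \<in> T \<Longrightarrow> \<bar>t - c\<bar> < r \<Longrightarrow> \<bar>t - c'\<bar> < r'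
      \<Longrightarrow> c = c' \<and> r = r'"
    and open_gates: "open G"
    and gate_base: "g \<in> G \<Longrightarrow> \<sigma> = 1 \<or> \<sigma> = -1 \<Longrightarrow> \<exists>c r. (c, r, \<sigma>) \<in> T \<and> \<bar>g - c\<bar> < r \<and> g \<noteq> c"
begin

definition surface :: "(real \<times> real) set" where
  "surface = (\<Union>(c, r, \<sigma>)\<in>T. tent_region c r \<sigma>) \<union> G \<times> {0}"

text \<open>
  The factors 2 keep the box away from the centre and from the boundary of the triangles, so that
  within the box the leaves do not reach the tops of their tents.
\<close>

definition adapted :: "real \<Rightarrow> real \<Rightarrow> (real \<Rightarrow> real) \<Rightarrow> (real \<Rightarrow> real) \<Rightarrow> bool" where
  "adapted x e s c \<longleftrightarrow> 0 < e \<and> {x - e<..<x + e} \<subseteq> G \<and>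
     (\<forall>\<sigma>\<in>{1, -1}. (s \<sigma> = 1 \<or> s \<sigma> = -1) \<and>
        (\<exists>r. (c \<sigma>, r, \<sigma>) \<in> T \<and> 2 * e \<le> s \<sigma> * (x - c \<sigma>) \<and> s \<sigma> * (x - c \<sigma>) + 2 * e \<le> r))"

definition atlas :: "(real \<times> real) chart set" where
  "atlas = {(tent_region c r \<sigma>, tent_map c) | c r \<sigma>. (c, r, \<sigma>) \<in> T} \<union>
           {(gate_box x e s, box_map s) | x e s c. adapted x e s c}"

lemma tent_region_chart: "(c, r, \<sigma>) \<in> T \<Longrightarrow> (tent_region c r \<sigma>, tent_map c) \<in> atlas"
  unfolding atlas_def by blast

lemma box_chart: "adapted x e s c \<Longrightarrow> (gate_box x e s, box_map s) \<in> atlas"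
  unfolding atlas_def by blast

lemma atlas_cases:
  assumes "(U, \<phi>) \<in> atlas"
  obtains (triangle) c r \<sigma> where "(c, r, \<sigma>) \<in> T" "U = tent_region c r \<sigma>" "\<phi> = tent_map c"
    | (box) x e s c where "adapted x e s c" "U = gate_box x e s" "\<phi> = box_map s"
  using assms unfolding atlas_def by blast

lemma tent_region_unique:
  assumes "(c, r, \<sigma>) \<in> T" "(c', r', \<sigma>') \<in> T" "p \<in> tent_region c r \<sigma>" "p \<in> tent_region c' r' \<sigma>'"
  shows "c = c'" "r = r'" "\<sigma> = \<sigma>'"
proof -
  show "\<sigma> = \<sigma>'"
    using side[OF assms(1)] side[OF assms(2)] assms(3,4) unfolding tent_region_def by auto
  then show "c = c'" "r = r'"
    using disjoint_bases[of c r \<sigma> c' r' "fst p"] assms unfolding tent_region_def by auto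
qed

lemma adaptedD:
  assumes "adapted x e s c" "\<sigma> = 1 \<or> \<sigma> = -1"
  obtains r where "(c \<sigma>, r, \<sigma>) \<in> T" "2 * e \<le> s \<sigma> * (x - c \<sigma>)" "s \<sigma> * (x - c \<sigma>) + 2 * e \<le> r"
    "s \<sigma> = 1 \<or> s \<sigma> = -1"
  using assms unfolding adapted_def by blast

lemma adapted_exists:
  assumes g: "g \<in> G" obtains e s c where "adapted g e s c"
proof -
  obtain c1 r1 where 1: "(c1, r1, 1) \<in> T" "\<bar>g - c1\<bar> < r1" "g \<noteq> c1"
    using gate_base[OF g] by blast
  obtain c2 r2 where 2: "(c2, r2, -1) \<in> T" "\<bar>g - c2\<bar> < r2" "g \<noteq> c2"
    using gate_base[OF g] by blast
  obtain d where d: "0 < d" "ball g d \<subseteq> G"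
    using openE[OF open_gates g] .
  define e where "e = min d (min (min (\<bar>g - c1\<bar> / 2) ((r1 - \<bar>g - c1\<bar>) / 2))
    (min (\<bar>g - c2\<bar> / 2) ((r2 - \<bar>g - c2\<bar>) / 2)))"
  define c where "c \<sigma> = (if \<sigma> = 1 then c1 else c2)" for \<sigma> :: real
  define r where "r \<sigma> = (if \<sigma> = 1 then r1 else r2)" for \<sigma> :: real
  have pos: "0 < e"
    using 1 2 d(1) unfolding e_def by simp
  have ed: "e \<le> d"
    unfolding e_def by (simp add: min_le_iff_disj)
  have "{g - e<..<g + e} \<subseteq> ball g d"
    using ed by (auto simp: dist_real_def abs_less_iff)
  then have gates: "{g - e<..<g + e} \<subseteq> G"
    using d(2) by (rule subset_trans)
  have ineqs: "e \<le> \<bar>g - c1\<bar> / 2" "e \<le> (r1 - \<bar>g - c1\<bar>) / 2"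
      "e \<le> \<bar>g - c2\<bar> / 2" "e \<le> (r2 - \<bar>g - c2\<bar>) / 2"
    unfolding e_def by (simp_all only: min_le_iff_disj order.refl simp_thms)
  have sides: "\<forall>\<sigma>\<in>{1, -1}. (sgn (g - c \<sigma>) = 1 \<or> sgn (g - c \<sigma>) = -1) \<and>
      (\<exists>r. (c \<sigma>, r, \<sigma>) \<in> T \<and> 2 * e \<le> sgn (g - c \<sigma>) * (g - c \<sigma>) \<and>
        sgn (g - c \<sigma>) * (g - c \<sigma>) + 2 * e \<le> r)"
  proof (intro ballI conjI exI)
    fix \<sigma> :: real assume \<sigma>: "\<sigma> \<in> {1, -1}"
    have abs: "sgn (g - c \<sigma>) * (g - c \<sigma>) = \<bar>g - c \<sigma>\<bar>"
      by (simp add: abs_sgn mult.commute)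
    show "(c \<sigma>, r \<sigma>, \<sigma>) \<in> T"
      using \<sigma> 1(1) 2(1) unfolding c_def r_def by auto
    show "2 * e \<le> sgn (g - c \<sigma>) * (g - c \<sigma>)" "sgn (g - c \<sigma>) * (g - c \<sigma>) + 2 * e \<le> r \<sigma>"
      using ineqs unfolding abs unfolding c_def r_def by (auto simp: field_simps)
    show "sgn (g - c \<sigma>) = 1 \<or> sgn (g - c \<sigma>) = -1"
      using 1(3) 2(3) unfolding c_def sgn_if by auto
  qed
  have "adapted g e (\<lambda>\<sigma>. sgn (g - c \<sigma>)) c"
    unfolding adapted_def by (intro conjI pos gates sides)
  then show ?thesis
    by (rule that)
qed

text \<open>
  The two transverse coordinates differ by the reflection in the centre or not at all.
\<close>

lemma box_tent:
  assumes a: "adapted x e s c" and p: "p \<in> gate_box x e s" and \<sigma>: "\<sigma> = 1 \<or> \<sigma> = -1" "0 < \<sigma> * snd p"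
  obtains r where "(c \<sigma>, r, \<sigma>) \<in> T" "p \<in> tent_region (c \<sigma>) r \<sigma>"
    "tent_end (c \<sigma>) p = c \<sigma> + s \<sigma> * (crossing s p - c \<sigma>)"
proof -
  obtain r where r: "(c \<sigma>, r, \<sigma>) \<in> T" "2 * e \<le> s \<sigma> * (x - c \<sigma>)" "s \<sigma> * (x - c \<sigma>) + 2 * e \<le> r"
    and s: "s \<sigma> = 1 \<or> s \<sigma> = -1"
    using adaptedD[OF a \<sigma>(1)] .
  have cr: "crossing s p = fst p + s \<sigma> * \<bar>snd p\<bar>"
    using crossing_side[OF \<sigma>(1)] \<sigma>(2) by simp
  have *: "\<bar>snd p\<bar> < e" "\<bar>crossing s p - x\<bar> < e"
    using p unfolding gate_box_def by auto
  have eq: "\<bar>fst p - c \<sigma>\<bar> + \<bar>snd p\<bar> = s \<sigma> * (crossing s p - c \<sigma>)"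
    using s * r(2) cr by (auto simp: abs_if split: if_splits)
  moreover have "s \<sigma> * (crossing s p - c \<sigma>) < r"
    using s * r(2,3) by (auto simp: abs_if split: if_splits)
  ultimately have "p \<in> tent_region (c \<sigma>) r \<sigma>"
    using \<sigma>(2) unfolding tent_region_def by simp
  then show ?thesis
    using that r(1) eq unfolding tent_end_def by simp
qed

lemma box_axis:
  assumes "adapted x e s c" "p \<in> gate_box x e s" "snd p = 0"
  shows "crossing s p = fst p" "fst p \<in> G"
  using assms unfolding adapted_def gate_box_def crossing_def by (auto simp: abs_less_iff subset_iff)

lemma tent_region_subset_surface: "(c, r, \<sigma>) \<in> T \<Longrightarrow> tent_region c r \<sigma> \<subseteq> surface"
  unfolding surface_def by blast

lemma box_subset_surface:
  assumes "adapted x e s c" shows "gate_box x e s \<subseteq> surface"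
proof
  fix p assume p: "p \<in> gate_box x e s"
  consider "snd p = 0" | "0 < 1 * snd p" | "0 < (-1) * snd p" by fastforce
  then show "p \<in> surface"
  proof cases
    case 1
    then show ?thesis
      using box_axis[OF assms p] unfolding surface_def by (auto simp: mem_Times_iff)
  next
    case 2
    obtain r where "(c 1, r, 1) \<in> T" "p \<in> tent_region (c 1) r 1"
      using box_tent[OF assms p disjI1[OF refl] 2] .
    then show ?thesis
      by (rule subsetD[OF tent_region_subset_surface])
  next
    case 3
    obtain r where "(c (-1), r, -1) \<in> T" "p \<in> tent_region (c (-1)) r (-1)"
      using box_tent[OF assms p disjI2[OF refl] 3] .
    then show ?thesis
      by (rule subsetD[OF tent_region_subset_surface])
  qed
qed

lemma gate_in_box: "adapted g e s c \<Longrightarrow> (g, 0) \<in> gate_box g e s"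
  unfolding adapted_def gate_box_def crossing_def by simp

lemma surface_cases:
  assumes "p \<in> surface"
  obtains (triangle) c r \<sigma> where "(c, r, \<sigma>) \<in> T" "p \<in> tent_region c r \<sigma>"
    | (gate) g e s c where "g \<in> G" "p = (g, 0)" "adapted g e s c" "p \<in> gate_box g e s"
proof (cases "\<exists>(c, r, \<sigma>)\<in>T. p \<in> tent_region c r \<sigma>")
  case True
  then show ?thesis
    using triangle by auto
next
  case False
  then obtain g where g: "g \<in> G" "p = (g, 0)"
    using assms unfolding surface_def by auto
  obtain e s c where "adapted g e s c"
    using adapted_exists[OF g(1)] .
  then show ?thesis
    using gate[OF g] gate_in_box g(2) by simp
qed

lemma open_surface: "open surface"
proof (subst open_subopen, intro ballI)
  fix p assume "p \<in> surface"
  then show "\<exists>N. open N \<and> p \<in> N \<and> N \<subseteq> surface"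
  proof (cases rule: surface_cases)
    case (triangle c r \<sigma>)
    then show ?thesis
      using open_tent_region tent_region_subset_surface by (intro exI[of _ "tent_region c r \<sigma>"]) simp
  next
    case (gate g e s c)
    then show ?thesis
      using open_box box_subset_surface by (intro exI[of _ "gate_box g e s"]) simp
  qed
qed

text \<open>
  Off the axis this makes all changes of charts affine in the transverse coordinate: every chart is
  compared with the chart of the triangle, and it differs from it by a reflection or not at all.
\<close>

lemma chart_on_tent_region:
  assumes "(U, \<phi>) \<in> atlas" "(c, r, \<sigma>) \<in> T" "p \<in> U" "p \<in> tent_region c r \<sigma>"
  obtains \<epsilon> where "\<epsilon> = 1 \<or> \<epsilon> = -1"
    "\<forall>q\<in>U \<inter> tent_region c r \<sigma>. snd (\<phi> q) = c + \<epsilon> * (tent_end c q - c)"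
  using assms(1)
proof (cases rule: atlas_cases)
  case (triangle c' r' \<sigma>')
  then have "c = c'"
    using tent_region_unique(1)[OF assms(2) triangle(1) assms(4)] assms(3) by simp
  then show ?thesis
    using that[of 1] triangle by (simp add: tent_map_def)
next
  case (box x e s c')
  have \<sigma>: "\<sigma> = 1 \<or> \<sigma> = -1"
    using side[OF assms(2)] .
  obtain r' where s: "s \<sigma> = 1 \<or> s \<sigma> = -1"
    using adaptedD[OF box(1) \<sigma>] .
  have "\<forall>q\<in>U \<inter> tent_region c r \<sigma>. snd (\<phi> q) = c + s \<sigma> * (tent_end c q - c)"
  proof
    fix q assume "q \<in> U \<inter> tent_region c r \<sigma>"
    then have q: "q \<in> U" "q \<in> tent_region c r \<sigma>"
      by auto
    have \<sigma>q: "0 < \<sigma> * snd q" and qb: "q \<in> gate_box x e s"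
      using q box(2) unfolding tent_region_def by auto
    obtain r' where r': "(c' \<sigma>, r', \<sigma>) \<in> T" "q \<in> tent_region (c' \<sigma>) r' \<sigma>"
      "tent_end (c' \<sigma>) q = c' \<sigma> + s \<sigma> * (crossing s q - c' \<sigma>)"
      using box_tent[OF box(1) qb \<sigma> \<sigma>q] .
    moreover have "c' \<sigma> = c"
      using tent_region_unique(1)[OF r'(1) assms(2) r'(2) q(2)] .
    ultimately show "snd (\<phi> q) = c + s \<sigma> * (tent_end c q - c)"
      using s unfolding box(3) box_map_def by auto
  qed
  then show ?thesis
    by (rule that[OF s])
qed

text \<open>
  A common point on the axis lies on a definite side of the centre of its triangle, and that
  determines the slopes.
\<close>

lemma crossings_agree:
  assumes "adapted x e s c" "adapted x' e' s' c'" "p \<in> gate_box x e s" "p \<in> gate_box x' e' s'" "snd p = 0"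
  shows "crossing s = crossing s'"
proof -
  have "s \<sigma> = s' \<sigma>" if \<sigma>: "\<sigma> = 1 \<or> \<sigma> = -1" for \<sigma>
  proof -
    have x: "\<bar>fst p - x\<bar> < e" "\<bar>fst p - x'\<bar> < e'"
      using assms box_axis(1)[OF assms(1,3,5)] box_axis(1)[OF assms(2,4,5)] unfolding gate_box_def by auto
    obtain r where r: "(c \<sigma>, r, \<sigma>) \<in> T" "2 * e \<le> s \<sigma> * (x - c \<sigma>)" "s \<sigma> * (x - c \<sigma>) + 2 * e \<le> r"
      "s \<sigma> = 1 \<or> s \<sigma> = -1"
      using adaptedD[OF assms(1) \<sigma>] .
    obtain r' where r': "(c' \<sigma>, r', \<sigma>) \<in> T" "2 * e' \<le> s' \<sigma> * (x' - c' \<sigma>)"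
      "s' \<sigma> * (x' - c' \<sigma>) + 2 * e' \<le> r'" "s' \<sigma> = 1 \<or> s' \<sigma> = -1"
      using adaptedD[OF assms(2) \<sigma>] .
    have "\<bar>fst p - c \<sigma>\<bar> < r" "\<bar>fst p - c' \<sigma>\<bar> < r'"
      using x r(2-4) r'(2-4) by (auto simp: abs_if split: if_splits)
    then have "c \<sigma> = c' \<sigma>"
      using disjoint_bases[OF r(1) r'(1)] by blast
    then show ?thesis
      using x r(2-4) r'(2-4) by (auto simp: abs_if split: if_splits)
  qed
  then show ?thesis
    by (simp add: crossing_def fun_eq_iff)
qed

lemma atlas_chart:
  assumes "(U, \<phi>) \<in> atlas" shows "foliated_chart surface (U, \<phi>)"
  using assms
proof (cases rule: atlas_cases)
  case (triangle c r \<sigma>)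
  then show ?thesis
    using foliated_chart_tent_region[OF side radius tent_region_subset_surface] by blast
next
  case (box x e s c)
  then show ?thesis
    using foliated_chart_box box_subset_surface unfolding adapted_def by blast
qed

lemma atlas_open: "(U, \<phi>) \<in> atlas \<Longrightarrow> open U"
  by (erule atlas_cases) (simp_all add: open_tent_region open_box)

lemma atlas_subset: "(U, \<phi>) \<in> atlas \<Longrightarrow> U \<subseteq> surface"
  by (erule atlas_cases) (simp_all add: tent_region_subset_surface box_subset_surface)

lemma axis_chart:
  assumes "(U, \<phi>) \<in> atlas" "p \<in> U" "snd p = 0"
  obtains x e s c where "adapted x e s c" "U = gate_box x e s" "\<phi> = box_map s"
  using assms(1)
proof (cases rule: atlas_cases)
  case (triangle c r \<sigma>)
  then show ?thesis
    using assms(2,3) unfolding tent_region_def by simp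
qed (rule that)

lemma atlas_foliation: "codim_one_foliation surface atlas"
  unfolding codim_one_foliation_def
proof (intro conjI ballI)
  show "foliated_chart surface d" if "d \<in> atlas" for d
    using atlas_chart that by (cases d) simp
  show "(\<Union>d\<in>atlas. fst d) = surface"
  proof
    show "(\<Union>d\<in>atlas. fst d) \<subseteq> surface"
      using atlas_subset by fastforce
    show "surface \<subseteq> (\<Union>d\<in>atlas. fst d)"
    proof
      fix p assume "p \<in> surface"
      then show "p \<in> (\<Union>d\<in>atlas. fst d)"
      proof (cases rule: surface_cases)
        case (triangle c r \<sigma>)
        then show ?thesis
          by (intro UN_I[OF tent_region_chart[OF triangle(1)]]) simp
      next
        case (gate g e s c)
        then show ?thesis
          by (intro UN_I[OF box_chart[OF gate(3)]]) simp
      qed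
    qed
  qed
next
  fix d1 d2 assume d: "d1 \<in> atlas" "d2 \<in> atlas"
  obtain U \<phi> V \<xi> where d_eq: "d1 = (U, \<phi>)" "d2 = (V, \<xi>)"
    by (cases d1, cases d2) simp
  have U: "(U, \<phi>) \<in> atlas" and V: "(V, \<xi>) \<in> atlas"
    using d d_eq by auto
  show "foliated_compatible surface d1 d2"
    unfolding d_eq
  proof (rule foliated_compatibleI[OF atlas_chart[OF U]])
    fix p assume p: "p \<in> U" "p \<in> V"
    have "p \<in> surface"
      using p atlas_subset[OF U] by blast
    then show "\<exists>W h. openin (top_of_set surface) W \<and> p \<in> W \<and> W \<subseteq> U \<inter> V \<and>
        (\<forall>q\<in>W. snd (\<xi> q) = h (snd (\<phi> q)))"
    proof (cases rule: surface_cases)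
      case (triangle c r \<sigma>)
      obtain \<epsilon> where 1: "\<epsilon> = 1 \<or> \<epsilon> = -1"
        "\<forall>q\<in>U \<inter> tent_region c r \<sigma>. snd (\<phi> q) = c + \<epsilon> * (tent_end c q - c)"
        using chart_on_tent_region[OF U triangle(1) p(1) triangle(2)] .
      obtain \<delta> where 2: "\<delta> = 1 \<or> \<delta> = -1"
        "\<forall>q\<in>V \<inter> tent_region c r \<sigma>. snd (\<xi> q) = c + \<delta> * (tent_end c q - c)"
        using chart_on_tent_region[OF V triangle(1) p(2) triangle(2)] .
      have "open (U \<inter> V \<inter> tent_region c r \<sigma>)"
        using atlas_open[OF U] atlas_open[OF V] open_tent_region by blast
      then have "openin (top_of_set surface) (U \<inter> V \<inter> tent_region c r \<sigma>)"
        using atlas_subset[OF U] by (intro open_subset) auto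
      moreover have "\<forall>q\<in>U \<inter> V \<inter> tent_region c r \<sigma>. snd (\<xi> q) = c + \<delta> * (\<epsilon> * (snd (\<phi> q) - c))"
        using 1 2 by auto
      ultimately show ?thesis
        using p triangle(2)
        by (intro exI[of _ "U \<inter> V \<inter> tent_region c r \<sigma>"] exI[of _ "\<lambda>v. c + \<delta> * (\<epsilon> * (v - c))"]) auto
    next
      case (gate g e s c)
      have "openin (top_of_set surface) (U \<inter> V)"
        using atlas_open[OF U] atlas_open[OF V] atlas_subset[OF U] by (intro open_subset) auto
      moreover have "snd (\<xi> q) = snd (\<phi> q)" for q
      proof -
        have p0: "snd p = 0"
          using gate by simp
        obtain x e s c where 1: "adapted x e s c" "U = gate_box x e s" "\<phi> = box_map s"
          using axis_chart[OF U p(1) p0] .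
        obtain x' e' s' c' where 2: "adapted x' e' s' c'" "V = gate_box x' e' s'" "\<xi> = box_map s'"
          using axis_chart[OF V p(2) p0] .
        have "crossing s = crossing s'"
          by (rule crossings_agree[OF 1(1) 2(1) _ _ p0]) (use p 1 2 in simp_all)
        then show ?thesis
          by (simp add: 1 2 box_map_def)
      qed
      ultimately show ?thesis
        using p by (intro exI[of _ "U \<inter> V"] exI[of _ "\<lambda>v. v"]) auto
    qed
  qed
qed

text \<open>
  A candidate for a union of leaves: \<open>M \<sigma>\<close> lists ends of tents on the side \<open>\<sigma>\<close>. On the axis \<open>M 1\<close>
  may stand for both sides because \<open>M 1\<close> and \<open>M (-1)\<close> have the same gates when \<open>M\<close> is consistent
  in the sense below.
\<close>

definition pattern_set :: "(real \<Rightarrow> real set) \<Rightarrow> (real \<times> real) set" where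
  "pattern_set M = {p. (\<exists>(c, r, \<sigma>)\<in>T. p \<in> tent_region c r \<sigma> \<and> tent_end c p \<in> M \<sigma>) \<or>
     snd p = 0 \<and> fst p \<in> G \<inter> M 1}"

lemma pattern_set_subset: "pattern_set M \<subseteq> surface"
  unfolding pattern_set_def surface_def by (auto simp: mem_Times_iff)

lemma pattern_set_tent_region:
  assumes "(c, r, \<sigma>) \<in> T" "p \<in> tent_region c r \<sigma>"
  shows "p \<in> pattern_set M \<longleftrightarrow> tent_end c p \<in> M \<sigma>"
proof -
  have "snd p \<noteq> 0"
    using assms(2) unfolding tent_region_def by auto
  then have "p \<in> pattern_set M \<longleftrightarrow>
      (\<exists>(c', r', \<sigma>')\<in>T. p \<in> tent_region c' r' \<sigma>' \<and> tent_end c' p \<in> M \<sigma>')"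
    unfolding pattern_set_def by simp
  also have "\<dots> \<longleftrightarrow> tent_end c p \<in> M \<sigma>"
  proof
    assume "\<exists>(c', r', \<sigma>')\<in>T. p \<in> tent_region c' r' \<sigma>' \<and> tent_end c' p \<in> M \<sigma>'"
    then obtain c' r' \<sigma>' where *: "(c', r', \<sigma>') \<in> T" "p \<in> tent_region c' r' \<sigma>'" "tent_end c' p \<in> M \<sigma>'"
      by auto
    then show "tent_end c p \<in> M \<sigma>"
      using tent_region_unique[OF assms(1) *(1) assms(2) *(2)] by simp
  next
    assume "tent_end c p \<in> M \<sigma>"
    then show "\<exists>(c', r', \<sigma>')\<in>T. p \<in> tent_region c' r' \<sigma>' \<and> tent_end c' p \<in> M \<sigma>'"
      using assms by (intro bexI[of _ "(c, r, \<sigma>)"]) simp_all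
  qed
  finally show ?thesis .
qed

text \<open>
  The condition on \<open>M\<close> under which \<open>pattern_set M\<close> is a union of plaques: both ends of a tent are
  in or both are out, and at a gate the upper and the lower tent are in or out together.
\<close>

definition consistent :: "(real \<Rightarrow> real set) \<Rightarrow> bool" where
  "consistent M \<longleftrightarrow>
     (\<forall>(c, r, \<sigma>)\<in>T. \<forall>t\<in>M \<sigma>. \<bar>t - c\<bar> < r \<longrightarrow> 2 * c - t \<in> M \<sigma>) \<and>
     (\<forall>g\<in>G. g \<in> M 1 \<longleftrightarrow> g \<in> M (-1))"

text \<open>
  The trace of a pattern set on a chart depends on the transverse coordinate only. This gives
  saturation, and it also gives the finiteness of traces when \<open>M\<close> is locally finite.
\<close>

lemma pattern_set_traces:
  assumes M: "consistent M" and U: "(U, \<phi>) \<in> atlas"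
  obtains \<sigma> u v where "\<sigma> = 1 \<or> \<sigma> = -1"
    "\<forall>p\<in>U. p \<in> pattern_set M \<longleftrightarrow> snd (\<phi> p) \<in> M \<sigma> \<inter> {u<..<v}"
  using U
proof (cases rule: atlas_cases)
  case (triangle c r \<sigma>)
  have "\<forall>p\<in>U. p \<in> pattern_set M \<longleftrightarrow> snd (\<phi> p) \<in> M \<sigma> \<inter> {c<..<c + r}"
  proof
    fix p assume p: "p \<in> U"
    have "tent_end c p \<in> {c<..<c + r}"
      using p triangle(2) unfolding tent_region_def tent_end_def by (auto simp: zero_less_mult_iff)
    then show "p \<in> pattern_set M \<longleftrightarrow> snd (\<phi> p) \<in> M \<sigma> \<inter> {c<..<c + r}"
      using p pattern_set_tent_region[OF triangle(1)] triangle by (simp add: tent_map_def)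
  qed
  then show ?thesis
    by (rule that[OF side[OF triangle(1)]])
next
  case (box x e s c)
  have "\<forall>p\<in>U. p \<in> pattern_set M \<longleftrightarrow> snd (\<phi> p) \<in> M 1 \<inter> {x - e<..<x + e}"
  proof
    fix p assume p: "p \<in> U"
    define t where "t = crossing s p"
    have t: "t \<in> {x - e<..<x + e}" "snd (\<phi> p) = t"
      using p box unfolding t_def gate_box_def box_map_def by (auto simp: abs_less_iff)
    then have tG: "t \<in> G"
      using box(1) unfolding adapted_def by blast
    have "p \<in> pattern_set M \<longleftrightarrow> t \<in> M 1"
    proof (cases "snd p = 0")
      case True
      then show ?thesis
        using box_axis[OF box(1)] p box(2) unfolding pattern_set_def t_def tent_region_def by auto
    next
      case False
      then obtain \<sigma> where \<sigma>: "\<sigma> = 1 \<or> \<sigma> = -1" "0 < \<sigma> * snd p"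
        by (metis linorder_neqE_linordered_idom mult_1 mult_minus1 neg_0_less_iff_less)
      obtain r where r: "(c \<sigma>, r, \<sigma>) \<in> T" "p \<in> tent_region (c \<sigma>) r \<sigma>"
          "tent_end (c \<sigma>) p = c \<sigma> + s \<sigma> * (t - c \<sigma>)"
        using box_tent[OF box(1) p[unfolded box(2)] \<sigma>] unfolding t_def .
      have s: "s \<sigma> = 1 \<or> s \<sigma> = -1"
        using adaptedD[OF box(1) \<sigma>(1)] .
      have "\<bar>t - c \<sigma>\<bar> < r" "\<bar>(2 * c \<sigma> - t) - c \<sigma>\<bar> < r"
        using r(2,3) s unfolding tent_region_def tent_end_def by auto
      then have "t \<in> M \<sigma> \<longleftrightarrow> 2 * c \<sigma> - t \<in> M \<sigma>"
        using M r(1) unfolding consistent_def by force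
      moreover have "tent_end (c \<sigma>) p = t \<or> tent_end (c \<sigma>) p = 2 * c \<sigma> - t"
        using s r(3) by auto
      ultimately have "p \<in> pattern_set M \<longleftrightarrow> t \<in> M \<sigma>"
        using pattern_set_tent_region[OF r(1,2), of M] by metis
      then show ?thesis
        using M tG \<sigma>(1) unfolding consistent_def by auto
    qed
    then show "p \<in> pattern_set M \<longleftrightarrow> snd (\<phi> p) \<in> M 1 \<inter> {x - e<..<x + e}"
      using t by simp
  qed
  then show ?thesis
    by (rule that[OF disjI1[OF refl]])
qed

lemma pattern_set_saturated:
  assumes "consistent M" shows "saturated atlas (pattern_set M)"
  unfolding saturated_def
proof clarify
  fix U \<phi> p q
  assume *: "(U, \<phi>) \<in> atlas" "p \<in> U" "q \<in> U" "snd (\<phi> p) = snd (\<phi> q)"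
  obtain \<sigma> u v where "\<forall>p\<in>U. p \<in> pattern_set M \<longleftrightarrow> snd (\<phi> p) \<in> M \<sigma> \<inter> {u<..<v}"
    using pattern_set_traces[OF assms *(1)] .
  then show "p \<in> pattern_set M \<longleftrightarrow> q \<in> pattern_set M"
    using *(2-4) by simp
qed

text \<open>
  The holonomy step: a leaf that contains one tent ending at a gate contains all tents ending there.
  The tents are linked by a plaque of a box around the gate, which meets each of them.
\<close>

lemma through_gate:
  assumes L: "saturated atlas L" and g: "g \<in> G"
    and c: "(c, r, \<sigma>) \<in> T" "\<bar>g - c\<bar> < r" "p \<in> tent_region c r \<sigma>" "tent_end c p = c + \<bar>g - c\<bar>"
    and c': "(c', r', \<sigma>') \<in> T" "\<bar>g - c'\<bar> < r'" "q \<in> tent_region c' r' \<sigma>'" "tent_end c' q = c' + \<bar>g - c'\<bar>"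
    and p: "p \<in> L"
  shows "q \<in> L"
proof -
  obtain e s k where a: "adapted g e s k"
    using adapted_exists[OF g] .
  have e: "0 < e"
    using a unfolding adapted_def by simp
  \<comment> \<open>One point on each side of the axis, both on the plaque through the gate.\<close>
  define z where "z \<sigma> = (g - s \<sigma> * (e / 2), \<sigma> * (e / 2))" for \<sigma>
  have z: "z \<sigma> \<in> gate_box g e s" "crossing s (z \<sigma>) = g" "z \<sigma> \<in> tent_region c r \<sigma>" "tent_end c (z \<sigma>) = c + \<bar>g - c\<bar>"
    if c: "(c, r, \<sigma>) \<in> T" "\<bar>g - c\<bar> < r" for c r \<sigma>
  proof -
    have \<sigma>: "\<sigma> = 1 \<or> \<sigma> = -1"
      using side[OF c(1)] .
    obtain R where R: "(k \<sigma>, R, \<sigma>) \<in> T" "2 * e \<le> s \<sigma> * (g - k \<sigma>)" "s \<sigma> * (g - k \<sigma>) + 2 * e \<le> R"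
      "s \<sigma> = 1 \<or> s \<sigma> = -1"
      using adaptedD[OF a \<sigma>] .
    have abs: "s \<sigma> * (g - k \<sigma>) = \<bar>g - k \<sigma>\<bar>"
      using R(2,4) e by auto
    then have "\<bar>g - k \<sigma>\<bar> < R"
      using R(3) e by simp
    then have k: "k \<sigma> = c"
      using disjoint_bases[OF R(1) c(1) _ c(2)] by blast
    have z0: "0 < \<sigma> * snd (z \<sigma>)" "\<bar>snd (z \<sigma>)\<bar> = e / 2"
      using \<sigma> e unfolding z_def by auto
    then show cr: "crossing s (z \<sigma>) = g"
      using crossing_side[OF \<sigma>, of "z \<sigma>" s] by (simp add: z_def)
    show box: "z \<sigma> \<in> gate_box g e s"
      using cr z0 e unfolding gate_box_def by simp
    obtain R' where R': "(k \<sigma>, R', \<sigma>) \<in> T" "z \<sigma> \<in> tent_region (k \<sigma>) R' \<sigma>"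
      "tent_end (k \<sigma>) (z \<sigma>) = k \<sigma> + s \<sigma> * (crossing s (z \<sigma>) - k \<sigma>)"
      using box_tent[OF a box \<sigma> z0(1)] .
    then show "tent_end c (z \<sigma>) = c + \<bar>g - c\<bar>"
      using cr abs k by simp
    then show "z \<sigma> \<in> tent_region c r \<sigma>"
      using z0 c(2) unfolding tent_region_def tent_end_def by simp
  qed
  have "z \<sigma> \<in> L"
    by (rule saturatedD[OF L tent_region_chart[OF c(1)] c(3) z(3)[OF c(1,2)] _ p])
       (use c(4) z(4)[OF c(1,2)] in \<open>simp add: tent_map_def\<close>)
  then have "z \<sigma>' \<in> L"
    by (rule saturatedD[OF L box_chart[OF a] z(1)[OF c(1,2)] z(1)[OF c'(1,2)], rotated])
       (use z(2)[OF c(1,2)] z(2)[OF c'(1,2)] in \<open>simp add: box_map_def\<close>)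
  then show "q \<in> L"
    by (rule saturatedD[OF L tent_region_chart[OF c'(1)] z(3)[OF c'(1,2)] c'(3), rotated])
       (use c'(4) z(4)[OF c'(1,2)] in \<open>simp add: tent_map_def\<close>)
qed

text \<open>
  Moving a point of the open set vertically away from the axis changes the end of its tent at unit
  speed.
\<close>

lemma open_set_meets_tents:
  assumes W: "openin (top_of_set surface) W" "W \<noteq> {}"
  obtains c r \<sigma> u v where "(c, r, \<sigma>) \<in> T" "u < v"
    "\<forall>t\<in>{u<..<v}. \<exists>q\<in>W \<inter> tent_region c r \<sigma>. tent_end c q = t"
proof -
  have oW: "open W" and WS: "W \<subseteq> surface"
    using W(1) open_surface openin_open_eq by blast+
  obtain p where p: "p \<in> W"
    using W(2) by blast
  obtain d where d: "0 < d" "ball p d \<subseteq> W"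
    using openE[OF oW p] .
  obtain q where q: "q \<in> W" "snd q \<noteq> 0"
  proof (cases "snd p = 0")
    case True
    have "dist p (fst p, d / 2) < d"
      using True d(1) by (simp add: dist_prod_def)
    then show ?thesis
      using that[of "(fst p, d / 2)"] d by auto
  qed (use p that in blast)
  then have "q \<in> surface" 
    using WS by blast
  then obtain c r \<sigma> where c: "(c, r, \<sigma>) \<in> T" "q \<in> tent_region c r \<sigma>"
    using q(2) by (cases rule: surface_cases) auto
  have oWt: "open (W \<inter> tent_region c r \<sigma>)"
    using oW open_tent_region by blast
  have qWt: "q \<in> W \<inter> tent_region c r \<sigma>"
    using q(1) c(2) by blast
  obtain \<epsilon> where \<epsilon>: "0 < \<epsilon>" "ball q \<epsilon> \<subseteq> W \<inter> tent_region c r \<sigma>"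
    using openE[OF oWt qWt] .
  have "\<forall>t\<in>{tent_end c q<..<tent_end c q + \<epsilon>}. \<exists>z\<in>W \<inter> tent_region c r \<sigma>. tent_end c z = t"
  proof
    fix t assume "t \<in> {tent_end c q<..<tent_end c q + \<epsilon>}"
    then have t: "tent_end c q < t" "t < tent_end c q + \<epsilon>"
      by auto
    \<comment> \<open>The vertical displacement that lengthens the tent by the right amount.\<close>
    define z where "z = (fst q, snd q + \<sigma> * (t - tent_end c q))"
    have \<sigma>: "\<sigma> = 1 \<or> \<sigma> = -1" "0 < \<sigma> * snd q"
      using side[OF c(1)] c(2) unfolding tent_region_def by auto
    have "dist q z = \<bar>t - tent_end c q\<bar>"
      using \<sigma> unfolding z_def dist_prod_def by (auto simp: dist_real_def)
    then have "z \<in> W \<inter> tent_region c r \<sigma>"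
      using \<epsilon>(2) t by auto
    moreover have "\<bar>snd z\<bar> = \<bar>snd q\<bar> + (t - tent_end c q)"
      using \<sigma> t unfolding z_def by auto
    then have "tent_end c z = t"
      unfolding tent_end_def by (simp add: z_def tent_end_def)
    ultimately show "\<exists>z\<in>W \<inter> tent_region c r \<sigma>. tent_end c z = t"
      by blast
  qed
  then show ?thesis
    by (rule that[OF c(1), rotated]) (use \<epsilon>(1) in simp)
qed

lemma saturated_meets_tent_region:
  assumes L: "saturated atlas L" and p: "p \<in> L" "p \<in> surface"
  obtains c r \<sigma> q where "(c, r, \<sigma>) \<in> T" "q \<in> tent_region c r \<sigma>" "q \<in> L"
  using p(2)
proof (cases rule: surface_cases)
  case (triangle c r \<sigma>)
  then show ?thesis
    using that p(1) by blast
next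
  case (gate g e s c)
  have e: "0 < e"
    using gate(3) unfolding adapted_def by simp
  define z where "z = (g - s 1 * (e / 2), e / 2)"
  have cr: "crossing s z = g"
    using crossing_side[of 1 z s] e unfolding z_def by simp
  have z: "z \<in> gate_box g e s"
    unfolding gate_box_def using cr e by (simp add: z_def)
  have z0: "0 < 1 * snd z"
    using e unfolding z_def by simp
  have "crossing s p = g"
    unfolding gate(2) crossing_def by simp
  then have "z \<in> L"
    by (intro saturatedD[OF L box_chart[OF gate(3)] gate(4) z _ p(1)]) (simp add: box_map_def cr)
  moreover obtain r where "(c 1, r, 1) \<in> T" "z \<in> tent_region (c 1) r 1"
    using box_tent[OF gate(3) z disjI1[OF refl] z0] .
  ultimately show ?thesis
    using that by blast
qed

end

section \<open>Irrational rotations cut open along walls\<close>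

text \<open>
  Kronecker's theorem for arbitrarily late multiples: the target is shifted by \<open>n\<close> multiples
  of \<open>a\<close>.
\<close>

lemma irrational_multiples_dense:
  fixes a \<theta> u v :: real
  assumes "a \<notin> \<rat>" "u < v"
  obtains k m where "n \<le> k" "m \<in> \<int>" "u < \<theta> + real k * a - m" "\<theta> + real k * a - m < v"
proof -
  obtain h k where k: "k > 0"
    "\<bar>of_int k * a - of_int h - ((u + v) / 2 - \<theta> - real n * a)\<bar> < (v - u) / 2"
    using sequence_of_fractional_parts_is_dense[OF assms(1), of "(v - u) / 2"] assms(2)
    by (metis diff_gt_0_iff_gt half_gt_zero_iff)
  define x where "x = \<theta> + real (n + nat k) * a - of_int h"
  have "x - (u + v) / 2 = of_int k * a - of_int h - ((u + v) / 2 - \<theta> - real n * a)"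
    using k(1) unfolding x_def by (simp add: algebra_simps)
  then have "\<bar>x - (u + v) / 2\<bar> < (v - u) / 2"
    using k(2) by (simp only:)
  then have "u < x" "x < v"
    by (auto simp: abs_less_iff field_simps)
  then show ?thesis
    using that[of "n + nat k" "of_int h"] unfolding x_def by simp
qed

lemma finite_integer_translate: "finite {t::real. t - s \<in> \<int> \<and> u < t \<and> t < v}"
proof -
  have "{t. t - s \<in> \<int> \<and> u < t \<and> t < v} \<subseteq> (\<lambda>x. x + s) ` {x \<in> \<int>. u - s \<le> x \<and> x \<le> v - s}"
  proof
    fix t assume "t \<in> {t. t - s \<in> \<int> \<and> u < t \<and> t < v}"
    then show "t \<in> (\<lambda>x. x + s) ` {x \<in> \<int>. u - s \<le> x \<and> x \<le> v - s}"
      by (intro image_eqI[of _ _ "t - s"]) auto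
  qed
  then show ?thesis
    by (rule finite_subset) (intro finite_imageI finite_int_segment)
qed

lemma Ints_eqI:
  fixes s t :: real
  assumes "t - s \<in> \<int>" "\<bar>s\<bar> < 1 / 2" "\<bar>t\<bar> < 1 / 2"
  shows "t = s"
proof -
  obtain n where n: "t - s = of_int n"
    using assms(1) by (auto elim: Ints_cases)
  have "\<bar>t - s\<bar> < 1"
    using assms(2,3) by linarith
  then have "n = 0"
    using n by simp
  then show ?thesis
    using n by simp
qed

text \<open>
  The walls \<open>B\<close> are a subset of the circle, written as a periodic subset of the line. Symmetry of
  \<open>B\<close> means that both ends \<open>t\<close> and \<open>-t\<close> of an upper tent are walls or both are gates, so that
  the chain through \<open>t\<close> is cut exactly at the points of the orbit of \<open>t\<close> that lie in \<open>B\<close>. The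
  points called thorns are the centres and the corners of the triangles below.
\<close>

locale rotation_pattern =
  fixes a :: real and B :: "real set"
  assumes angle: "0 < a" "a < 1" "a \<notin> \<rat>"
    and closed_walls: "closed B"
    and walls_periodic: "t \<in> B \<Longrightarrow> m \<in> \<int> \<Longrightarrow> t + m \<in> B"
    and walls_symmetric: "t \<in> B \<Longrightarrow> - t \<in> B"
    and thorns: "0 \<in> B" "1 / 2 \<in> B" "a / 2 \<in> B" "a / 2 + 1 / 2 \<in> B" "a + 1 / 2 \<in> B"
    and returns: "\<exists>k\<ge>n. real k * a \<in> B"
    and generic: "\<exists>\<theta>. \<forall>k::nat. \<theta> + real k * a \<notin> B"
begin

definition T :: "(real \<times> real \<times> real) set" where
  "T = {(0, 1 / 2, 1), (a / 2, (1 - a) / 2, -1), ((a - 1) / 2, a / 2, -1)}"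

definition G :: "real set" where
  "G = {-1 / 2<..<1 / 2} - B"

lemma walls_shift: "s \<in> B \<Longrightarrow> t - s \<in> \<int> \<Longrightarrow> t \<in> B"
  using walls_periodic[of s "t - s"] by simp

lemma walls_reflect: "s \<in> B \<Longrightarrow> t + s \<in> \<int> \<Longrightarrow> t \<in> B"
  using walls_shift[OF walls_symmetric, of s t] by simp

sublocale tent_pattern T G
proof
  fix c r \<sigma> assume *: "(c, r, \<sigma>) \<in> T"
  show "\<sigma> = 1 \<or> \<sigma> = -1" "0 < r"
    using * angle unfolding T_def by auto
next
  fix c r \<sigma> c' r' t
  assume *: "(c, r, \<sigma>) \<in> T" "(c', r', \<sigma>) \<in> T" "\<bar>t - c\<bar> < r" "\<bar>t - c'\<bar> < r'"
  show "c = c' \<and> r = r'"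
    using * angle unfolding T_def by (auto simp: abs_if field_simps split: if_splits)
next
  show "open G"
    unfolding G_def using closed_walls by (intro open_Diff) auto
next
  fix g \<sigma> assume g: "g \<in> G" and \<sigma>: "\<sigma> = 1 \<or> \<sigma> = (-1::real)"
  have *: "g \<notin> B" "-1 / 2 < g" "g < 1 / 2"
    using g unfolding G_def by auto
  have "g \<noteq> 0" "g \<noteq> a / 2"
    using * thorns by auto
  moreover have "g \<noteq> (a - 1) / 2"
    using *(1) walls_periodic[OF thorns(4), of "-1"] by (auto simp: field_simps)
  moreover have "g \<noteq> a - 1 / 2"
    using *(1) walls_periodic[OF thorns(5), of "-1"] by auto
  moreover have "\<bar>g - a / 2\<bar> < (1 - a) / 2" if "a - 1 / 2 < g"
    using that * by (simp add: abs_less_iff field_simps)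
  moreover have "\<bar>g - (a - 1) / 2\<bar> < a / 2" if "g < a - 1 / 2"
    using that * by (simp add: abs_less_iff field_simps)
  moreover have "\<bar>g - 0\<bar> < 1 / 2"
    using * by (simp add: abs_less_iff)
  ultimately show "\<exists>c r. (c, r, \<sigma>) \<in> T \<and> \<bar>g - c\<bar> < r \<and> g \<noteq> c"
    using \<sigma> unfolding T_def by (metis insertCI linorder_less_linear)
qed

text \<open>
  Modulo 1, the tents on the side \<open>\<sigma>\<close> join \<open>t\<close> to \<open>offset \<sigma> - t\<close>. For the two lower triangles
  this is the same formula, because their centres differ by \<open>1/2\<close>.
\<close>

definition offset :: "real \<Rightarrow> real" where
  "offset \<sigma> = (if \<sigma> = 1 then 0 else a)"

definition same_arc :: "real \<Rightarrow> real \<Rightarrow> real \<Rightarrow> bool" where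
  "same_arc \<sigma> t s \<longleftrightarrow> t - s \<in> \<int> \<or> t + s - offset \<sigma> \<in> \<int>"

lemma same_arc_refl: "same_arc \<sigma> t t"
  unfolding same_arc_def by simp

lemma same_arc_sym: "same_arc \<sigma> t s \<Longrightarrow> same_arc \<sigma> s t"
  unfolding same_arc_def using Ints_minus[of "t - s"] by (auto simp: add.commute)

lemma same_arc_trans:
  assumes "same_arc \<sigma> t s" "same_arc \<sigma> s x" shows "same_arc \<sigma> t x"
proof -
  have 1: "t - x = (t - s) + (s - x)" "t - x = (t + s - offset \<sigma>) - (s + x - offset \<sigma>)"
    "t + x - offset \<sigma> = (t + s - offset \<sigma>) - (s - x)"
    "t + x - offset \<sigma> = (t - s) + (s + x - offset \<sigma>)"
    by simp_all
  show ?thesis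
    using assms Ints_add Ints_diff unfolding same_arc_def by (metis 1)
qed

lemma centre_offset:
  assumes "(c, r, \<sigma>) \<in> T" shows "2 * c - offset \<sigma> \<in> \<int>"
proof -
  have "2 * c - offset \<sigma> = 0 \<or> 2 * c - offset \<sigma> = -1"
    using assms unfolding T_def offset_def by auto
  then show ?thesis
    by auto
qed

lemma same_arc_reflect: "(c, r, \<sigma>) \<in> T \<Longrightarrow> same_arc \<sigma> (2 * c - t) t"
  using centre_offset unfolding same_arc_def by simp

lemma base_bound: "(c, r, \<sigma>) \<in> T \<Longrightarrow> \<bar>t - c\<bar> < r \<Longrightarrow> \<bar>t\<bar> < 1 / 2"
  using angle unfolding T_def by (auto simp: abs_less_iff field_simps)

text \<open>
  The bases of the triangles lie in one fundamental domain \<open>(-1/2, 1/2)\<close> of the circle, so working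
  modulo 1 does not identify different tents.
\<close>

lemma same_arc_unique:
  assumes "(c, r, \<sigma>) \<in> T" "\<bar>t - c\<bar> < r" "(c', r', \<sigma>) \<in> T" "\<bar>s - c'\<bar> < r'" "same_arc \<sigma> t s"
  shows "c = c'" "r = r'" "\<bar>t - c\<bar> = \<bar>s - c'\<bar>"
proof -
  have *: "c = c' \<and> r = r' \<and> \<bar>t - c\<bar> = \<bar>s - c'\<bar>" if x: "t - x \<in> \<int>" "\<bar>x - c'\<bar> = \<bar>s - c'\<bar>" for x
  proof -
    have "\<bar>x - c'\<bar> < r'"
      using x(2) assms(4) by simp
    moreover from this have "t = x"
      using Ints_eqI[OF x(1)] base_bound[OF assms(1,2)] base_bound[OF assms(3)] by blast
    ultimately show ?thesis
      using disjoint_bases[OF assms(1,3,2)] x(2) by simp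
  qed
  have "t - (2 * c' - s) = (t + s - offset \<sigma>) - (2 * c' - offset \<sigma>)"
    by simp
  then have "t - s \<in> \<int> \<or> t - (2 * c' - s) \<in> \<int>"
    using assms(5) centre_offset[OF assms(3)] Ints_diff unfolding same_arc_def by metis
  then have "c = c' \<and> r = r' \<and> \<bar>t - c\<bar> = \<bar>s - c'\<bar>"
  proof
    assume "t - s \<in> \<int>"
    then show ?thesis
      by (rule *) simp
  next
    assume "t - (2 * c' - s) \<in> \<int>"
    then show ?thesis
      by (rule *) simp
  qed
  then show "c = c'" "r = r'" "\<bar>t - c\<bar> = \<bar>s - c'\<bar>"
    by auto
qed

lemma tent_end_in_base:
  assumes "p \<in> tent_region c r \<sigma>"
  shows "c < tent_end c p" "\<bar>tent_end c p - c\<bar> < r"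
  using assms unfolding tent_region_def tent_end_def by (auto simp: zero_less_mult_iff)

text \<open>
  \<open>L\<close> contains the tent ending at \<open>\<theta>\<close> modulo 1. This is vacuous when there is no such tent, that is
  at the centres and corners of the triangles on that side.
\<close>

definition contains_arc :: "(real \<times> real) set \<Rightarrow> real \<Rightarrow> real \<Rightarrow> bool" where
  "contains_arc L \<sigma> \<theta> \<longleftrightarrow> (\<forall>c r p. (c, r, \<sigma>) \<in> T \<longrightarrow> p \<in> tent_region c r \<sigma> \<longrightarrow>
     same_arc \<sigma> (tent_end c p) \<theta> \<longrightarrow> p \<in> L)"

lemma contains_arcD:
  assumes "contains_arc L \<sigma> \<theta>" "(c, r, \<sigma>) \<in> T" "p \<in> tent_region c r \<sigma>"
    "same_arc \<sigma> (tent_end c p) \<theta>"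
  shows "p \<in> L"
  using assms unfolding contains_arc_def by blast

lemma contains_arc_cong:
  assumes "contains_arc L \<sigma> \<theta>" "same_arc \<sigma> \<theta> \<theta>'" shows "contains_arc L \<sigma> \<theta>'"
  unfolding contains_arc_def
  using contains_arcD[OF assms(1)] same_arc_trans[OF _ same_arc_sym[OF assms(2)]] by blast

lemma contains_arc_of_point:
  assumes L: "saturated atlas L" and p: "(c, r, \<sigma>) \<in> T" "p \<in> tent_region c r \<sigma>" "p \<in> L"
  shows "contains_arc L \<sigma> (tent_end c p)"
  unfolding contains_arc_def
proof (intro allI impI)
  fix c' r' q
  assume q: "(c', r', \<sigma>) \<in> T" "q \<in> tent_region c' r' \<sigma>" "same_arc \<sigma> (tent_end c' q) (tent_end c p)"
  note eq = same_arc_unique[OF q(1) tent_end_in_base(2)[OF q(2)] p(1) tent_end_in_base(2)[OF p(2)] q(3)]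
  have "tent_end c q = tent_end c p"
    using eq(3) tent_end_in_base(1)[OF q(2)] tent_end_in_base(1)[OF p(2)] unfolding eq(1) by simp
  then show "q \<in> L"
    using saturatedD[OF L tent_region_chart[OF p(1)] p(2) _ _ p(3), of q] q(2)
    unfolding eq(1,2) by (simp add: tent_map_def)
qed

lemma nearest_gate:
  assumes "\<theta> \<notin> B" obtains g where "g \<in> G" "g - \<theta> \<in> \<int>"
proof -
  define g where "g = \<theta> - of_int (round \<theta>)"
  have int: "g - \<theta> \<in> \<int>"
    unfolding g_def by simp
  then have gB: "g \<notin> B"
    using walls_shift[of g \<theta>] assms Ints_minus[of "g - \<theta>"] by auto
  have "\<bar>g\<bar> \<le> 1 / 2"
    unfolding g_def using of_int_round_abs_le[of \<theta>] by (simp add: abs_minus_commute)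
  moreover have "g \<noteq> 1 / 2" "g \<noteq> - (1 / 2)"
    using gB thorns(2) walls_symmetric[OF thorns(2)] by metis+
  ultimately have "g \<in> G"
    using gB unfolding G_def by (auto simp: abs_le_iff)
  then show ?thesis
    using that int by blast
qed

lemma contains_arc_through_gate:
  assumes L: "saturated atlas L" and \<theta>: "\<theta> \<notin> B"
    and \<sigma>: "\<sigma> = 1 \<or> \<sigma> = -1" "\<sigma>' = 1 \<or> \<sigma>' = -1" and arc: "contains_arc L \<sigma> \<theta>"
  shows "contains_arc L \<sigma>' \<theta>"
  unfolding contains_arc_def
proof (intro allI impI)
  fix c' r' q
  assume q: "(c', r', \<sigma>') \<in> T" "q \<in> tent_region c' r' \<sigma>'" "same_arc \<sigma>' (tent_end c' q) \<theta>"
  obtain g where g: "g \<in> G" "g - \<theta> \<in> \<int>"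
    using nearest_gate[OF \<theta>] .
  have g\<theta>: "same_arc s g \<theta>" for s
    using g(2) unfolding same_arc_def by simp
  obtain k R where k: "(k, R, \<sigma>) \<in> T" "\<bar>g - k\<bar> < R" "g \<noteq> k"
    using gate_base[OF g(1) \<sigma>(1)] by blast
  obtain k' R' where k': "(k', R', \<sigma>') \<in> T" "\<bar>g - k'\<bar> < R'" "g \<noteq> k'"
    using gate_base[OF g(1) \<sigma>(2)] by blast
  \<comment> \<open>The top of the tent that ends at the gate.\<close>
  define p where "p = (k, \<sigma> * \<bar>g - k\<bar>)"
  have p: "p \<in> tent_region k R \<sigma>" "tent_end k p = k + \<bar>g - k\<bar>"
    using k \<sigma>(1) unfolding p_def tent_region_def tent_end_def by auto
  have "tent_end k p = g \<or> tent_end k p = 2 * k - g"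
    unfolding p(2) by auto
  then have "same_arc \<sigma> (tent_end k p) g"
    using same_arc_refl same_arc_reflect[OF k(1)] by metis
  then have "p \<in> L"
    by (rule contains_arcD[OF arc k(1) p(1) same_arc_trans[OF _ g\<theta>]])
  note eq = same_arc_unique[OF q(1) tent_end_in_base(2)[OF q(2)] k'(1,2)
      same_arc_trans[OF q(3) same_arc_sym[OF g\<theta>]]]
  have "tent_end c' q = c' + \<bar>g - c'\<bar>"
    using eq(1,3) tent_end_in_base(1)[OF q(2)] by simp
  then show "q \<in> L"
    using through_gate[OF L g(1) k(1,2) p q(1) _ q(2) _ \<open>p \<in> L\<close>] k'(2) unfolding eq(1,2) by simp
qed

text \<open>
  From the upper tent at \<open>\<phi>\<close> the leaf passes through the gate \<open>-\<phi>\<close> to the lower tent at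
  \<open>-\<phi>\<close>, the other end of which is \<open>\<phi> + a\<close>, and through that gate to the upper tent at \<open>\<phi> + a\<close>.
\<close>

lemma contains_orbit:
  assumes L: "saturated atlas L" and \<theta>: "\<And>k::nat. \<theta> + real k * a \<notin> B"
    and arc: "contains_arc L 1 \<theta>"
  shows "contains_arc L 1 (\<theta> + real k * a) \<and> contains_arc L (-1) (\<theta> + real (Suc k) * a)"
proof -
  have step: "contains_arc L (-1) (\<phi> + a)" if \<phi>: "contains_arc L 1 \<phi>" "\<phi> \<notin> B" for \<phi>
  proof -
    have "contains_arc L 1 (- \<phi>)"
      by (rule contains_arc_cong[OF \<phi>(1)]) (simp add: same_arc_def offset_def)
    moreover have "- \<phi> \<notin> B"
      using \<phi>(2) walls_symmetric[of "- \<phi>"] by auto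
    ultimately have "contains_arc L (-1) (- \<phi>)"
      using contains_arc_through_gate[OF L, of "- \<phi>" 1 "-1"] by simp
    then show ?thesis
      by (rule contains_arc_cong) (simp add: same_arc_def offset_def)
  qed
  have suc: "\<theta> + real (Suc k) * a = (\<theta> + real k * a) + a" for k
    by (simp add: algebra_simps)
  show ?thesis
  proof (induction k)
    case 0
    then show ?case
      using arc step[OF arc] \<theta>[of 0] by simp
  next
    case (Suc k)
    then have "contains_arc L 1 (\<theta> + real (Suc k) * a)"
      using contains_arc_through_gate[OF L \<theta>[of "Suc k"], of "-1" 1] by simp
    then show ?case
      using step[of "\<theta> + real (Suc k) * a"] \<theta>[of "Suc k"] by (simp only: suc[of "Suc k"] simp_thms)
  qed
qed

lemma orbit_in_open_set:
  assumes W: "openin (top_of_set surface) W" "W \<noteq> {}"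
  obtains c r \<sigma> q k m where "(c, r, \<sigma>) \<in> T" "q \<in> tent_region c r \<sigma>" "q \<in> W" "m \<in> \<int>"
    "tent_end c q = \<theta> + real (Suc k) * a - m"
proof -
  obtain c r \<sigma> u v where T: "(c, r, \<sigma>) \<in> T" and uv: "u < v"
    and q: "\<forall>t\<in>{u<..<v}. \<exists>q\<in>W \<inter> tent_region c r \<sigma>. tent_end c q = t"
    using open_set_meets_tents[OF W] .
  obtain k m where k: "1 \<le> k" "m \<in> \<int>" "u < \<theta> + real k * a - m" "\<theta> + real k * a - m < v"
    using irrational_multiples_dense[OF angle(3) uv] .
  obtain j where j: "k = Suc j"
    using k(1) by (cases k) auto
  obtain q where "q \<in> W \<inter> tent_region c r \<sigma>" "tent_end c q = \<theta> + real k * a - m"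
    using q k(3,4) by force
  then show ?thesis
    using that[OF T _ _ k(2)] j by blast
qed

lemma orbit_dense:
  assumes L: "saturated atlas L" "L \<subseteq> surface" and \<theta>: "\<And>k::nat. \<theta> + real k * a \<notin> B"
    and arc: "contains_arc L 1 \<theta>"
  shows "(top_of_set surface) closure_of L = surface"
proof -
  have "L \<inter> W \<noteq> {}" if W: "openin (top_of_set surface) W" "W \<noteq> {}" for W
  proof -
    obtain c r \<sigma> q k m where q: "(c, r, \<sigma>) \<in> T" "q \<in> tent_region c r \<sigma>" "q \<in> W" "m \<in> \<int>"
      "tent_end c q = \<theta> + real (Suc k) * a - m"
      using orbit_in_open_set[OF W] .
    have "contains_arc L \<sigma> (\<theta> + real (Suc k) * a)"
      using contains_orbit[OF L(1) \<theta> arc, of k] contains_orbit[OF L(1) \<theta> arc, of "Suc k"] side[OF q(1)]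
      by auto
    then have "q \<in> L"
      by (rule contains_arcD[OF _ q(1,2)]) (use q(4,5) in \<open>simp add: same_arc_def\<close>)
    then show ?thesis
      using q(3) by blast
  qed
  then have "(top_of_set surface) closure_of L = topspace (top_of_set surface)"
    unfolding dense_intersects_open by auto
  then show ?thesis
    by simp
qed

text \<open>
  The ends of the tents in the chain of the orbit points \<open>\<theta> + n a\<close> with \<open>i \<le> n \<le> j\<close>. The chain has
  one lower tent less than upper tents, since the lower tent at \<open>\<theta> + n a\<close> joins the upper tents
  number \<open>n - 1\<close> and \<open>n\<close>.
\<close>

definition segment_ends :: "real \<Rightarrow> int \<Rightarrow> int \<Rightarrow> real \<Rightarrow> real set" where
  "segment_ends \<theta> i j \<sigma> =
     {t. \<exists>n. (if \<sigma> = 1 then i else i + 1) \<le> n \<and> n \<le> j \<and> same_arc \<sigma> t (\<theta> + of_int n * a)}"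

lemma finite_segment_ends: "finite (segment_ends \<theta> i j \<sigma> \<inter> {u<..<v})"
proof -
  have "segment_ends \<theta> i j \<sigma> \<inter> {u<..<v} \<subseteq> (\<Union>n\<in>{i..j}.
      {t. t - (\<theta> + of_int n * a) \<in> \<int> \<and> u < t \<and> t < v} \<union>
      {t. t - (offset \<sigma> - (\<theta> + of_int n * a)) \<in> \<int> \<and> u < t \<and> t < v})"
  proof
    fix t assume t: "t \<in> segment_ends \<theta> i j \<sigma> \<inter> {u<..<v}"
    then have "\<exists>n. (if \<sigma> = 1 then i else i + 1) \<le> n \<and> n \<le> j \<and> same_arc \<sigma> t (\<theta> + of_int n * a)"
      unfolding segment_ends_def by (simp only: Int_iff mem_Collect_eq)
    then obtain n where n0: "(if \<sigma> = 1 then i else i + 1) \<le> n"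
      and n: "n \<le> j" "same_arc \<sigma> t (\<theta> + of_int n * a)"
      by (elim exE conjE)
    have tuv: "u < t" "t < v"
      using t by simp_all
    from n0 have "i \<le> n"
      by (simp split: if_splits)
    have eq: "t - (offset \<sigma> - (\<theta> + of_int n * a)) = t + (\<theta> + of_int n * a) - offset \<sigma>"
      by simp
    have "t - (\<theta> + of_int n * a) \<in> \<int> \<or> t - (offset \<sigma> - (\<theta> + of_int n * a)) \<in> \<int>"
      using n(2) unfolding same_arc_def eq .
    then show "t \<in> (\<Union>n\<in>{i..j}.
      {t. t - (\<theta> + of_int n * a) \<in> \<int> \<and> u < t \<and> t < v} \<union>
      {t. t - (offset \<sigma> - (\<theta> + of_int n * a)) \<in> \<int> \<and> u < t \<and> t < v})"
      using n(1) tuv \<open>i \<le> n\<close> by (intro UN_I[of n]) auto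
  qed
  then show ?thesis
    by (rule finite_subset) (intro finite_UN_I finite_UnI finite_integer_translate, simp)
qed

text \<open>
  The chain could be left only at its two outer ends, and these are walls.
\<close>

lemma segment_consistent:
  assumes i: "\<theta> + of_int i * a \<in> B" and j: "\<theta> + of_int j * a \<in> B"
  shows "consistent (segment_ends \<theta> i j)"
  unfolding consistent_def
proof (intro conjI ballI)
  fix T' assume "T' \<in> T"
  moreover have "2 * c - t \<in> segment_ends \<theta> i j \<sigma>" if "(c, r, \<sigma>) \<in> T" "t \<in> segment_ends \<theta> i j \<sigma>" for c r \<sigma> t
    using same_arc_trans[OF same_arc_reflect[OF that(1)]] that(2) unfolding segment_ends_def by blast
  ultimately show "case T' of (c, r, \<sigma>) \<Rightarrow>
      \<forall>t\<in>segment_ends \<theta> i j \<sigma>. \<bar>t - c\<bar> < r \<longrightarrow> 2 * c - t \<in> segment_ends \<theta> i j \<sigma>"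
    by auto
next
  fix g assume "g \<in> G"
  then have g: "g \<notin> B"
    unfolding G_def by blast
  show "g \<in> segment_ends \<theta> i j 1 \<longleftrightarrow> g \<in> segment_ends \<theta> i j (-1)"
  proof
    assume "g \<in> segment_ends \<theta> i j 1"
    then obtain n where n: "i \<le> n" "n \<le> j" and or: "g - (\<theta> + of_int n * a) \<in> \<int> \<or> g + (\<theta> + of_int n * a) \<in> \<int>"
      unfolding segment_ends_def same_arc_def offset_def by auto
    from or show "g \<in> segment_ends \<theta> i j (-1)"
    proof
      assume *: "g - (\<theta> + of_int n * a) \<in> \<int>"
      then have "n \<noteq> i"
        using walls_shift[OF i] g by auto
      then show ?thesis
        using n * unfolding segment_ends_def same_arc_def by (auto intro!: exI[of _ n])
    next
      assume *: "g + (\<theta> + of_int n * a) \<in> \<int>"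
      then have "n \<noteq> j"
        using walls_reflect[OF j] g by auto
      moreover have "g + (\<theta> + of_int (n + 1) * a) - a \<in> \<int>"
        using * by (simp add: algebra_simps)
      then have "same_arc (-1) g (\<theta> + of_int (n + 1) * a)"
        unfolding same_arc_def offset_def by simp
      ultimately show ?thesis
        using n unfolding segment_ends_def
        by (simp only: mem_Collect_eq) (intro exI[of _ "n + 1"], simp)
    qed
  next
    assume "g \<in> segment_ends \<theta> i j (-1)"
    then obtain n where n: "i + 1 \<le> n" "n \<le> j"
      and or: "g - (\<theta> + of_int n * a) \<in> \<int> \<or> g + (\<theta> + of_int n * a) - a \<in> \<int>"
      unfolding segment_ends_def same_arc_def offset_def by auto
    from or show "g \<in> segment_ends \<theta> i j 1"
    proof
      assume "g - (\<theta> + of_int n * a) \<in> \<int>"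
      then show ?thesis
        using n unfolding segment_ends_def same_arc_def by (auto intro!: exI[of _ n])
    next
      assume "g + (\<theta> + of_int n * a) - a \<in> \<int>"
      then have "g + (\<theta> + of_int (n - 1) * a) \<in> \<int>"
        by (simp add: algebra_simps)
      then have "same_arc 1 g (\<theta> + of_int (n - 1) * a)"
        unfolding same_arc_def offset_def by simp
      then show ?thesis
        using n unfolding segment_ends_def
        by (simp only: mem_Collect_eq) (intro exI[of _ "n - 1"], simp)
    qed
  qed
qed

lemma segment_finite_traces:
  assumes L: "L \<in> leaves surface atlas"
    and p: "(c, r, \<sigma>) \<in> T" "p \<in> tent_region c r \<sigma>" "p \<in> L"
    and i: "(if \<sigma> = 1 then i else i + 1) \<le> 0" "tent_end c p + of_int i * a \<in> B"
    and j: "0 \<le> j" "tent_end c p + of_int j * a \<in> B"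
    and U: "(U, \<phi>) \<in> atlas"
  shows "finite (snd ` \<phi> ` (L \<inter> U))"
proof -
  let ?M = "segment_ends (tent_end c p) i j"
  have M: "consistent ?M"
    by (rule segment_consistent[OF i(2) j(2)])
  have "tent_end c p \<in> ?M \<sigma>"
    using i(1) j(1) same_arc_refl unfolding segment_ends_def by (auto intro!: exI[of _ 0])
  then have "p \<in> pattern_set ?M"
    using pattern_set_tent_region[OF p(1,2)] by simp
  then have sub: "L \<subseteq> pattern_set ?M"
    by (rule leaf_subset_saturated[OF atlas_foliation L p(3) _ pattern_set_subset pattern_set_saturated[OF M]])
  obtain \<tau> u v where "\<forall>q\<in>U. q \<in> pattern_set ?M \<longleftrightarrow> snd (\<phi> q) \<in> ?M \<tau> \<inter> {u<..<v}"
    using pattern_set_traces[OF M U] .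
  then have "snd ` \<phi> ` (L \<inter> U) \<subseteq> ?M \<tau> \<inter> {u<..<v}"
    using sub by auto
  then show ?thesis
    by (rule finite_subset[OF _ finite_segment_ends])
qed

definition finite_traces :: "(real \<times> real) set \<Rightarrow> bool" where
  "finite_traces L \<longleftrightarrow> (\<forall>(U, \<phi>)\<in>atlas. finite (snd ` \<phi> ` (L \<inter> U)))"

text \<open>
  A leaf contains some tent with end \<open>t\<close>. If the orbit of \<open>t\<close> meets a wall in both directions, the
  leaf lies in a finite chain. If it meets none in the forward direction, the leaf follows the forward
  orbit of \<open>t\<close>; if it meets none in the backward direction, then it follows the forward orbit of the
  other end of the tent.
\<close>

lemma leaf_dichotomy:
  assumes L: "L \<in> leaves surface atlas"
  shows "finite_traces L \<or> (top_of_set surface) closure_of L = surface"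
proof -
  note sat = leaf_saturated[OF atlas_foliation L]
  note sub = leaf_nonempty_subset(2)[OF atlas_foliation L]
  note dense = orbit_dense[OF sat sub]
  obtain p where "p \<in> L"
    using leaf_nonempty_subset(1)[OF atlas_foliation L] by blast
  then obtain c r \<sigma> q where q: "(c, r, \<sigma>) \<in> T" "q \<in> tent_region c r \<sigma>" "q \<in> L"
    using saturated_meets_tent_region[OF sat] sub by blast
  define t where "t = tent_end c q"
  have arc: "contains_arc L \<sigma> t"
    unfolding t_def by (rule contains_arc_of_point[OF sat q])
  have \<sigma>: "\<sigma> = 1 \<or> \<sigma> = -1"
    by (rule side[OF q(1)])
  \<comment> \<open>Behind \<open>t\<close>, the first possible wall is \<open>t\<close> for an upper tent and \<open>t - a\<close> for a lower one.\<close>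
  define l0 :: nat where "l0 = (if \<sigma> = 1 then 0 else 1)"
  consider (forward) "\<forall>k::nat. t + real k * a \<notin> B" | (backward) "\<forall>l\<ge>l0. t - real l * a \<notin> B"
    | (finite) j l where "t + real j * a \<in> B" "l0 \<le> l" "t - real l * a \<in> B"
    by blast
  then show ?thesis
  proof cases
    case forward
    have "t \<notin> B"
      using forward[rule_format, of 0] by simp
    then have "contains_arc L 1 t"
      using contains_arc_through_gate[OF sat _ \<sigma> disjI1[OF refl] arc] by simp
    then show ?thesis
      using dense forward by blast
  next
    case backward
    show ?thesis
    proof (cases "\<sigma> = 1")
      case True
      have "contains_arc L 1 (- t)"
        using arc unfolding True by (rule contains_arc_cong) (simp add: same_arc_def offset_def)
      moreover have "- t + real k * a \<notin> B" for k
        using backward[rule_format, of k] walls_symmetric[of "- t + real k * a"] True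
        unfolding l0_def by (auto simp: algebra_simps)
      ultimately show ?thesis
        using dense by blast
    next
      case False
      have nB: "a - t + real k * a \<notin> B" for k
        using backward[rule_format, of "Suc k"] walls_symmetric[of "a - t + real k * a"] False
        unfolding l0_def by (auto simp: algebra_simps)
      have "contains_arc L (-1) t"
        using arc \<sigma> False by simp
      then have "contains_arc L (-1) (a - t)"
        by (rule contains_arc_cong) (simp add: same_arc_def offset_def)
      then have "contains_arc L 1 (a - t)"
        using contains_arc_through_gate[OF sat, of "a - t" "-1" 1] nB[of 0] by simp
      then show ?thesis
        using dense nB by blast
    qed
  next
    case (finite j l)
    have "finite (snd ` \<phi> ` (L \<inter> U))" if "(U, \<phi>) \<in> atlas" for U \<phi>
      by (rule segment_finite_traces[OF L q, of "- int l" "int j" U \<phi>])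
         (use finite that in \<open>auto simp: t_def l0_def split: if_splits\<close>)
    then show ?thesis
      unfolding finite_traces_def by blast
  qed
qed

lemma finite_traces_leaf_type:
  assumes "L \<in> leaves surface atlas" "finite_traces L"
  shows "proper_leaf surface atlas L" "\<not> locally_dense_leaf surface L"
proof -
  have "\<And>U \<phi>. (U, \<phi>) \<in> atlas \<Longrightarrow> finite (snd ` \<phi> ` (L \<inter> U))"
    using assms(2) unfolding finite_traces_def by blast
  then show "proper_leaf surface atlas L" "\<not> locally_dense_leaf surface L"
    using finite_traces_proper[OF atlas_foliation assms(1)]
      finite_traces_not_locally_dense[OF atlas_foliation assms(1)] by blast+
qed

text \<open>
  The positive orbit of the wall \<open>0\<close> is dense, and each of its points has the wall \<open>0\<close> behind it and
  a wall \<open>n a\<close> ahead of it.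
\<close>

lemma finite_leaf_in_open_set:
  assumes W: "openin (top_of_set surface) W" "W \<noteq> {}"
  obtains L p where "L \<in> leaves surface atlas" "finite_traces L" "p \<in> L" "p \<in> W"
proof -
  obtain c r \<sigma> q k m where q: "(c, r, \<sigma>) \<in> T" "q \<in> tent_region c r \<sigma>" "q \<in> W" "m \<in> \<int>"
    "tent_end c q = 0 + real (Suc k) * a - m"
    using orbit_in_open_set[OF W] .
  have "q \<in> surface"
    using q(3) openin_imp_subset[OF W(1)] by blast
  then obtain L where L: "L \<in> leaves surface atlas" "q \<in> L"
    using leaf_through[OF atlas_foliation] by blast
  obtain n where n: "Suc k \<le> n" "real n * a \<in> B"
    using returns by blast
  have "tent_end c q + of_int (- int (Suc k)) * a = - m"
    using q(5) by (simp add: algebra_simps)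
  then have "tent_end c q + of_int (- int (Suc k)) * a \<in> B"
    using walls_shift[OF thorns(1), of "- m"] q(4) by simp
  moreover have "tent_end c q + of_int (int n - int (Suc k)) * a \<in> B"
  proof (rule walls_shift[OF n(2)])
    have "tent_end c q + of_int (int n - int (Suc k)) * a - real n * a = - m"
      using q(5) by (simp add: algebra_simps)
    then show "tent_end c q + of_int (int n - int (Suc k)) * a - real n * a \<in> \<int>"
      using q(4) by simp
  qed
  ultimately have "finite (snd ` \<phi> ` (L \<inter> U))" if "(U, \<phi>) \<in> atlas" for U \<phi>
    by (intro segment_finite_traces[OF L(1) q(1,2) L(2) _ _ _ _ that, of "- int (Suc k)" "int n - int (Suc k)"])
       (use n(1) in auto)
  then show ?thesis
    using that[OF L(1) _ L(2) q(3)] unfolding finite_traces_def by blast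
qed

lemma dense_leaf_exists:
  obtains L where "L \<in> leaves surface atlas" "(top_of_set surface) closure_of L = surface"
proof -
  obtain \<theta> where \<theta>: "\<And>k::nat. \<theta> + real k * a \<notin> B"
    using generic by blast
  obtain g where g: "g \<in> G" "g - \<theta> \<in> \<int>"
    using nearest_gate[of \<theta>] \<theta>[of 0] by auto
  \<comment> \<open>The top of an upper tent.\<close>
  define p where "p = (0::real, \<bar>g\<bar>)"
  have "(0, 1 / 2, 1) \<in> T"
    unfolding T_def by simp
  moreover have "p \<in> tent_region 0 (1 / 2) 1"
    using g(1) thorns(1) unfolding p_def tent_region_def G_def by (auto simp: abs_less_iff)
  ultimately have p: "(0, 1 / 2, 1) \<in> T" "p \<in> tent_region 0 (1 / 2) 1" "p \<in> surface"
    using tent_region_subset_surface by blast+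
  obtain L where L: "L \<in> leaves surface atlas" "p \<in> L"
    using leaf_through[OF atlas_foliation p(3)] .
  note sat = leaf_saturated[OF atlas_foliation L(1)]
  have "tent_end 0 p = g \<or> tent_end 0 p = - g"
    unfolding p_def tent_end_def by auto
  then have "same_arc 1 (tent_end 0 p) g"
    unfolding same_arc_def offset_def by auto
  moreover have "same_arc 1 g \<theta>"
    using g(2) unfolding same_arc_def by simp
  ultimately have "contains_arc L 1 \<theta>"
    using contains_arc_cong[OF contains_arc_of_point[OF sat p(1,2) L(2)]] same_arc_trans by blast
  then show ?thesis
    using that L(1) orbit_dense[OF sat leaf_nonempty_subset(2)[OF atlas_foliation L(1)] \<theta>] by blast
qed

lemma dense_leaf_locally_dense:
  assumes "L \<in> leaves surface atlas" "(top_of_set surface) closure_of L = surface"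
  shows "locally_dense_leaf surface L"
proof -
  have "(top_of_set surface) interior_of surface = surface"
    using interior_of_topspace[of "top_of_set surface"] by simp
  then show ?thesis
    unfolding locally_dense_leaf_def assms(2)
    using leaf_nonempty_subset[OF atlas_foliation assms(1)] by auto
qed

text \<open>
  The surface lies between a dense leaf and its closure, which gives connectedness.
\<close>

lemma open_surface_in_plane_surface: "open_surface_in_plane surface"
proof -
  obtain L where L: "L \<in> leaves surface atlas" "(top_of_set surface) closure_of L = surface"
    by (rule dense_leaf_exists)
  have sub: "L \<noteq> {}" "L \<subseteq> surface"
    using leaf_nonempty_subset[OF atlas_foliation L(1)] .
  have "surface \<subseteq> closure L"
    using L(2) inf.absorb2[OF sub(2)] by (simp add: closure_of_subtopology) blast
  then have conn: "connected surface"
    using connected_intermediate_closure[OF leaf_connected[OF atlas_foliation L(1)] sub(2)] by blast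
  have "\<not> compact surface"
  proof
    assume "compact surface"
    then have "surface = UNIV"
      using sub open_surface clopen[of surface] compact_imp_closed by blast
    then have "bounded (UNIV :: (real \<times> real) set)"
      using \<open>compact surface\<close> compact_imp_bounded by metis
    then show False
      by (simp add: not_bounded_UNIV)
  qed
  moreover have "\<exists>U. openin (top_of_set surface) U \<and> p \<in> U \<and>
      (\<exists>V :: (real \<times> real) set. open V \<and> U homeomorphic V)" if "p \<in> surface" for p
    using that open_surface homeomorphic_refl by (intro exI[of _ surface]) auto
  ultimately show ?thesis
    unfolding open_surface_in_plane_def using conn sub by blast
qed

lemma leaf_finite_or_locally_dense:
  assumes "L \<in> leaves surface atlas"
  shows "finite_traces L \<or> L \<in> leaves_of_type surface atlas Locally_dense"
  using leaf_dichotomy[OF assms] dense_leaf_locally_dense[OF assms] assms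
  unfolding leaves_of_type_def by auto

lemma finite_traces_leaf_in_proper:
  "L \<in> leaves surface atlas \<Longrightarrow> finite_traces L \<Longrightarrow> L \<in> leaves_of_type surface atlas Proper"
  using finite_traces_leaf_type unfolding leaves_of_type_def by simp

lemma proper_union_dense: "(top_of_set surface) closure_of (\<Union>(leaves_of_type surface atlas Proper)) = surface"
proof -
  have "\<Union>(leaves_of_type surface atlas Proper) \<inter> W \<noteq> {}"
    if W: "openin (top_of_set surface) W" "W \<noteq> {}" for W
  proof -
    obtain L p where "L \<in> leaves surface atlas" "finite_traces L" "p \<in> L" "p \<in> W"
      using finite_leaf_in_open_set[OF W] .
    then show ?thesis
      using finite_traces_leaf_in_proper by blast
  qed
  then have "(top_of_set surface) closure_of (\<Union>(leaves_of_type surface atlas Proper)) = topspace (top_of_set surface)"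
    unfolding dense_intersects_open by auto
  then show ?thesis
    by simp
qed

lemma locally_dense_union_dense:
  "(top_of_set surface) closure_of (\<Union>(leaves_of_type surface atlas Locally_dense)) = surface"
proof -
  obtain L where L: "L \<in> leaves surface atlas" "(top_of_set surface) closure_of L = surface"
    by (rule dense_leaf_exists)
  have "L \<in> leaves_of_type surface atlas Locally_dense"
    using dense_leaf_locally_dense[OF L] L(1) unfolding leaves_of_type_def by simp
  then have "surface \<subseteq> (top_of_set surface) closure_of (\<Union>(leaves_of_type surface atlas Locally_dense))"
    using closure_of_mono[of L "\<Union>(leaves_of_type surface atlas Locally_dense)" "top_of_set surface"] L(2) by blast
  then show ?thesis
    using closure_of_subset_topspace[of "top_of_set surface"] by fastforce
qed

lemma rare_species_atlas: "rare_species surface atlas"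
proof -
  have ne: "surface \<noteq> {}"
    using open_surface_in_plane_surface unfolding open_surface_in_plane_def by blast
  have exc: "leaves_of_type surface atlas Exceptional = {}"
    using leaf_finite_or_locally_dense finite_traces_leaf_type unfolding leaves_of_type_def by auto
  have "leaves_of_type surface atlas Proper \<noteq> {}" "leaves_of_type surface atlas Locally_dense \<noteq> {}"
    using proper_union_dense locally_dense_union_dense ne by auto
  note nonempty = this
  have types: "{t. leaves_of_type surface atlas t \<noteq> {}} = {Proper, Locally_dense}"
  proof (intro set_eqI)
    fix t show "t \<in> {t. leaves_of_type surface atlas t \<noteq> {}} \<longleftrightarrow> t \<in> {Proper, Locally_dense}"
      using exc nonempty by (cases t) simp_all
  qed
  have "(top_of_set surface) closure_of (\<Union>(leaves_of_type surface atlas t)) = surface"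
    if "leaves_of_type surface atlas t \<noteq> {}" for t
    using that exc proper_union_dense locally_dense_union_dense by (cases t) simp_all
  then show ?thesis
    unfolding rare_species_def types by simp
qed

lemma locally_dense_union_not_open:
  "\<not> openin (top_of_set surface) (\<Union>(leaves_of_type surface atlas Locally_dense))"
proof
  assume op: "openin (top_of_set surface) (\<Union>(leaves_of_type surface atlas Locally_dense))"
  have "surface \<noteq> {}"
    using open_surface_in_plane_surface unfolding open_surface_in_plane_def by blast
  then have "\<Union>(leaves_of_type surface atlas Locally_dense) \<noteq> {}"
    using locally_dense_union_dense by (metis closure_of_empty)
  then obtain L p where L: "L \<in> leaves surface atlas" "finite_traces L" "p \<in> L"
    "p \<in> \<Union>(leaves_of_type surface atlas Locally_dense)"
    using finite_leaf_in_open_set[OF op] by blast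
  then obtain L' where L': "L' \<in> leaves surface atlas" "locally_dense_leaf surface L'" "p \<in> L'"
    unfolding leaves_of_type_def by auto
  then have "L' = L"
    using leaf_eq[OF atlas_foliation L'(1) L(1) L'(3) L(3)] by blast
  then show False
    using finite_traces_leaf_type(2)[OF L(1,2)] L'(2) by simp
qed

end

text \<open>
  The set of walls is \<open>\<int> + C\<close> with a compact countable set \<open>C\<close>, namely a sequence \<open>k\<^sub>n a - m\<^sub>n\<close> that
  converges to \<open>0\<close> together with its limit, the thorns and the negatives of all these.
\<close>

lemma rotation_pattern_exists: "\<exists>a B. rotation_pattern a B"
proof -
  obtain a :: real where a: "0 < a" "a < 1" "a \<notin> \<rat>"
  proof -
    have "\<not> {0<..<1::real} \<subseteq> \<rat>"
      using uncountable_open_interval[of 0 "1::real"] countable_rat countable_subset by auto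
    then obtain x :: real where "x \<in> {0<..<1}" "x \<notin> \<rat>"
      by blast
    then show ?thesis
      by (intro that[of x]) auto
  qed
  have "\<exists>k m. n \<le> k \<and> m \<in> \<int> \<and> \<bar>real k * a - m\<bar> < inverse (real (Suc n))" for n
  proof -
    have "0 < inverse (real (Suc n))"
      by simp
    then have "- inverse (real (Suc n)) < inverse (real (Suc n))"
      by linarith
    then obtain k m where "n \<le> k" "m \<in> \<int>" "- inverse (real (Suc n)) < 0 + real k * a - m"
      "0 + real k * a - m < inverse (real (Suc n))"
      using irrational_multiples_dense[OF a(3)] by blast
    then show ?thesis
      by (intro exI[of _ k] exI[of _ m]) (simp add: abs_less_iff)
  qed
  then obtain k m where k: "\<And>n. n \<le> k n" "\<And>n. m n \<in> \<int>"
      "\<And>n. \<bar>real (k n) * a - m n\<bar> < inverse (real (Suc n))"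
    by metis
  define \<delta> where "\<delta> n = real (k n) * a - m n" for n
  have "\<delta> \<longlonglongrightarrow> 0"
    unfolding \<delta>_def
    by (rule Lim_null_comparison[OF _ LIMSEQ_inverse_real_of_nat])
       (use k(3) in \<open>auto simp: less_imp_le\<close>)
  then have "compact (insert 0 (range \<delta>))"
    by (rule compact_sequence_with_limit)
  define C0 where "C0 = insert 0 (range \<delta>) \<union> {1 / 2, a / 2, a / 2 + 1 / 2, a + 1 / 2}"
  define C where "C = C0 \<union> uminus ` C0"
  define B where "B = (\<Union>x\<in>(\<int>::real set). \<Union>y\<in>C. {x + y})"
  have "compact C0"
    unfolding C0_def by (rule compact_Un[OF \<open>compact (insert 0 (range \<delta>))\<close> finite_imp_compact]) simp
  then have "compact C"
    unfolding C_def by (intro compact_Un compact_continuous_image continuous_intros)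
  have BI: "t \<in> B" if "t - c \<in> \<int>" "c \<in> C" for t c
    unfolding B_def using that by (intro UN_I[of "t - c"] UN_I[of c]) auto
  have C: "c \<in> B" if "c \<in> C0" for c
    using BI[of c c] that unfolding C_def by simp
  have "rotation_pattern a B"
  proof
    show "0 < a" "a < 1" "a \<notin> \<rat>"
      by (fact a)+
    show "closed B"
      unfolding B_def using \<open>compact C\<close> by (intro closed_compact_sums) auto
    show "t + m \<in> B" if "t \<in> B" "m \<in> \<int>" for t m
    proof -
      obtain x c where "x \<in> \<int>" "c \<in> C" "t = x + c"
        using \<open>t \<in> B\<close> unfolding B_def by blast
      then show ?thesis
        using BI[of "t + m" c] that(2) by simp
    qed
    show "- t \<in> B" if "t \<in> B" for t
    proof -
      obtain x c where "x \<in> \<int>" "c \<in> C" "t = x + c"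
        using \<open>t \<in> B\<close> unfolding B_def by blast
      moreover have "- c \<in> C"
        using \<open>c \<in> C\<close> unfolding C_def by auto
      ultimately show ?thesis
        using BI[of "- t" "- c"] by simp
    qed
    show "0 \<in> B" "1 / 2 \<in> B" "a / 2 \<in> B" "a / 2 + 1 / 2 \<in> B" "a + 1 / 2 \<in> B"
      by (rule C; simp add: C0_def)+
    show "\<exists>j\<ge>n. real j * a \<in> B" for n
    proof (intro exI conjI)
      show "real (k n) * a \<in> B"
        by (rule BI[of _ "\<delta> n"]) (use k(2) in \<open>auto simp: \<delta>_def C_def C0_def\<close>)
    qed (fact k(1))
    show "\<exists>\<theta>. \<forall>j::nat. \<theta> + real j * a \<notin> B"
    proof -
      have "countable C0"
        unfolding C0_def by auto
      then have "countable B"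
        unfolding B_def C_def by (intro countable_UN countable_Un countable_image countable_int) auto
      then have "countable (\<Union>j::nat. (\<lambda>b. b - real j * a) ` B)"
        by (intro countable_UN countable_image) auto
      then obtain \<theta> where "\<theta> \<notin> (\<Union>j::nat. (\<lambda>b. b - real j * a) ` B)"
        using uncountable_UNIV_real by (metis UNIV_eq_I)
      then have "\<theta> + real j * a \<notin> B" for j :: nat
        by force
      then show ?thesis
        by blast
    qed
  qed
  then show ?thesis
    by blast
qed

theorem corollary2p11:
  "\<exists>(S :: (real \<times> real) set) \<F>.
     open_surface_in_plane S \<and> codim_one_foliation S \<F> \<and> rare_species S \<F> \<and>
     \<not> openin (top_of_set S) (\<Union>(leaves_of_type S \<F> Locally_dense))"
proof -
  obtain a B where "rotation_pattern a B"
    using rotation_pattern_exists by blast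
  then interpret rotation_pattern a B .
  show ?thesis
    using open_surface_in_plane_surface atlas_foliation rare_species_atlas
      locally_dense_union_not_open by blast
qed

end
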